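(* Let $f=q\star W$ be a Gaussian field on $\mathbb{R}^d$ satisfying the Basic Assumptions and the positive association assumption $q\geq 0$. Let $\ell\in\mathbb{R}$, and let $T$ be the pseudometric associated with $f$, $\ell$ and $\psi$. Then there exists a constant $C>0$ such that for every $x\in\mathbb{R}^d$ with $|x|\geq 2$, $$\operatorname{Var} T(0,x)\geq C.$$
   Context: Norm: $|\cdot|=\|\cdot\|$ denotes the sup norm on $\mathbb{R}^d$. Pseudometric: $\psi:\mathbb{R}\to\mathbb{R}$ is a fixed measurable function such that (1) $\psi\geq 0$; (2) $\psi$ is non-decreasing; (3) there is $C_\psi>0$ with $\psi(x)\leq C_\psi x$ for all $x\geq 1$; (4) $\psi(x)>0\Leftrightarrow x>0$. For an almost surely continuous Gaussian field $f$ on $\mathbb{R}^d$, $\ell\in\mathbb{R}$ and compact $A,B\subset\mathbb{R}^d$, $T(A,B):=\inf_\gamma\int_\gamma\psi(f+\ell)$, the infimum being over piecewise affine paths $\gamma$ from $A$ to $B$ and the integral being with respect to Euclidean length. $T(0,x)$ means $T(\{0\},\{x\})$. Basic Assumptions on $f$: (a) $f$ is centered, stationary and ergodic. (b) $f=q\star W$ with $q\in L^2(\mathbb{R}^d)$ and $W$ the white noise on $\mathbb{R}^d$ (so $f$ is the centered Gaussian field with covariance $\int q(x-u)q(y-u)\,du$); $q$ is called the moving-average kernel. (c) $q$ is $\mathcal{C}^3$, each of its derivatives is in $L^2(\mathbb{R}^d)$, and $q\in L^1(\mathbb{R}^d)$. (d) There is a function $F:\mathbb{R}\to\mathbb{R}$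 decaying to $0$ at $\infty$ (the decay function) such that for every $x\in\mathbb{R}$ and every multi-index $\beta$ with $|\beta|\leq 1$, $\big(\int_{\|u\|\geq x}|\partial^\beta q(u)|^2du\big)^{1/2}\leq F(x)$. (e) $q$ is invariant under permutations of the coordinate axes and under reflection in each axis. (f) $\int_{\mathbb{R}^d}q>0$. *)

theory Defs
  imports "HOL-Probability.Probability"
begin

section \<open>The moving-average kernel\<close>

definition square_integrable :: "(real^'n \<Rightarrow> real) \<Rightarrow> bool" where
  "square_integrable g \<longleftrightarrow>
     g \<in> borel_measurable borel \<and> integrable lborel (\<lambda>u. (g u)\<^sup>2)"

definition partial_deriv :: "'n \<Rightarrow> (real^'n \<Rightarrow> real) \<Rightarrow> real^'n \<Rightarrow> real" where
  "partial_deriv i g = (\<lambda>x. frechet_derivative g (at x) (axis i 1))"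

text \<open>A multi-index is encoded as a list of coordinates: the list \<open>[i\<^sub>1, \<dots>, i\<^sub>k]\<close>
  stands for the derivative of order \<open>k\<close> along these coordinates. For \<open>C\<^sup>k\<close> functions the
  order of the entries is immaterial.\<close>

definition iterated_partial :: "'n list \<Rightarrow> (real^'n \<Rightarrow> real) \<Rightarrow> real^'n \<Rightarrow> real" where
  "iterated_partial \<beta> g = foldr partial_deriv \<beta> g"

fun cont_diff :: "nat \<Rightarrow> (real^'n \<Rightarrow> real) \<Rightarrow> bool" where
  "cont_diff 0 g \<longleftrightarrow> continuous_on UNIV g"
| "cont_diff (Suc k) g \<longleftrightarrow>
     (\<forall>x. g differentiable (at x)) \<and> (\<forall>i. cont_diff k (partial_deriv i g))"

section \<open>Gaussian processes, white noise, stationarity and ergodicity\<close>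

text \<open>Constants count as (degenerate) Gaussian random variables.\<close>

definition gaussian_rv :: "'w measure \<Rightarrow> ('w \<Rightarrow> real) \<Rightarrow> bool" where
  "gaussian_rv M X \<longleftrightarrow> X \<in> borel_measurable M \<and>
     ((\<exists>\<mu>. AE \<omega> in M. X \<omega> = \<mu>) \<or>
      (\<exists>\<mu> \<sigma>. \<sigma> > 0 \<and> distributed M lborel X (normal_density \<mu> \<sigma>)))"

definition gaussian_process :: "'w measure \<Rightarrow> 'i set \<Rightarrow> ('i \<Rightarrow> 'w \<Rightarrow> real) \<Rightarrow> bool" where
  "gaussian_process M I X \<longleftrightarrow>
     (\<forall>J c. finite J \<and> J \<subseteq> I \<longrightarrow> gaussian_rv M (\<lambda>\<omega>. \<Sum>j\<in>J. c j * X j \<omega>))"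

text \<open>White noise on \<open>\<real>\<^sup>d\<close>, as the isonormal Gaussian process indexed by \<open>L\<^sup>2(\<real>\<^sup>d)\<close>:
  \<open>W g\<close> is the stochastic integral of \<open>g\<close>.\<close>

definition white_noise :: "'w measure \<Rightarrow> ((real^'n \<Rightarrow> real) \<Rightarrow> 'w \<Rightarrow> real) \<Rightarrow> bool" where
  "white_noise M W \<longleftrightarrow>
     gaussian_process M {g. square_integrable g} W \<and>
     (\<forall>g. square_integrable g \<longrightarrow> (LINT \<omega>|M. W g \<omega>) = 0) \<and>
     (\<forall>g h. square_integrable g \<and> square_integrable h \<longrightarrow>
        (LINT \<omega>|M. W g \<omega> * W h \<omega>) = (LINT u|lborel. g u * h u))"

definition moving_average ::
    "'w measure \<Rightarrow> ((real^'n \<Rightarrow> real) \<Rightarrow> 'w \<Rightarrow> real) \<Rightarrow> (real^'n \<Rightarrow> real)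
       \<Rightarrow> (real^'n \<Rightarrow> 'w \<Rightarrow> real) \<Rightarrow> bool" where
  "moving_average M W q f \<longleftrightarrow> (\<forall>x. AE \<omega> in M. f x \<omega> = W (\<lambda>u. q (x - u)) \<omega>)"

definition stationary :: "'w measure \<Rightarrow> (real^'n \<Rightarrow> 'w \<Rightarrow> real) \<Rightarrow> bool" where
  "stationary M f \<longleftrightarrow>
     (\<forall>a. distr M (\<Pi>\<^sub>M x\<in>UNIV. borel) (\<lambda>\<omega> x. f (x + a) \<omega>) =
          distr M (\<Pi>\<^sub>M x\<in>UNIV. borel) (\<lambda>\<omega> x. f x \<omega>))"

text \<open>Invariance of events is required only up to null sets. In the product sigma-algebra on
  all functions, strictly invariant sets are trivial (a member depends on countably many
  coordinates only), so strict invariance would make the condition void.\<close>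

definition ergodic :: "'w measure \<Rightarrow> (real^'n \<Rightarrow> 'w \<Rightarrow> real) \<Rightarrow> bool" where
  "ergodic M f \<longleftrightarrow>
     (\<forall>A \<in> sets (\<Pi>\<^sub>M x\<in>(UNIV :: (real^'n) set). (borel :: real measure)).
        (\<forall>a. AE \<omega> in M. (\<lambda>x. f (x + a) \<omega>) \<in> A \<longleftrightarrow> (\<lambda>x. f x \<omega>) \<in> A) \<longrightarrow>
        (AE \<omega> in M. (\<lambda>x. f x \<omega>) \<in> A) \<or> (AE \<omega> in M. (\<lambda>x. f x \<omega>) \<notin> A))"

definition basic_assumptions ::
    "'w measure \<Rightarrow> ((real^'n \<Rightarrow> real) \<Rightarrow> 'w \<Rightarrow> real) \<Rightarrow> (real^'n \<Rightarrow> real)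
       \<Rightarrow> (real^'n \<Rightarrow> 'w \<Rightarrow> real) \<Rightarrow> bool" where
  "basic_assumptions M W q f \<longleftrightarrow>
     gaussian_process M UNIV f \<and> (AE \<omega> in M. continuous_on UNIV (\<lambda>x. f x \<omega>)) \<and>
     (\<forall>x. (LINT \<omega>|M. f x \<omega>) = 0) \<and> stationary M f \<and> ergodic M f \<and>
     square_integrable q \<and> white_noise M W \<and> moving_average M W q f \<and>
     cont_diff 3 q \<and> (\<forall>\<beta>. length \<beta> \<le> 3 \<longrightarrow> square_integrable (iterated_partial \<beta> q)) \<and>
     integrable lborel q \<and>
     (\<exists>F :: real \<Rightarrow> real. (F \<longlongrightarrow> 0) at_top \<and>
        (\<forall>x \<beta>. length \<beta> \<le> 1 \<longrightarrow>
           sqrt (LINT u:{u. infnorm u \<ge> x}|lborel. \<bar>iterated_partial \<beta> q u\<bar>\<^sup>2) \<le> F x)) \<and>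
     (\<forall>\<pi> u. \<pi> permutes UNIV \<longrightarrow> q (\<chi> i. u $ \<pi> i) = q u) \<and>
     (\<forall>i u. q (\<chi> j. if j = i then - u $ j else u $ j) = q u) \<and>
     (LINT u|lborel. q u) > 0"

section \<open>The pseudometric\<close>

definition admissible_psi :: "(real \<Rightarrow> real) \<Rightarrow> bool" where
  "admissible_psi \<psi> \<longleftrightarrow>
     \<psi> \<in> borel_measurable borel \<and> (\<forall>x. \<psi> x \<ge> 0) \<and> mono \<psi> \<and>
     (\<exists>C>0. \<forall>x\<ge>1. \<psi> x \<le> C * x) \<and> (\<forall>x. \<psi> x > 0 \<longleftrightarrow> x > 0)"

definition piecewise_affine_path :: "(real \<Rightarrow> real^'n) \<Rightarrow> bool" where
  "piecewise_affine_path \<gamma> \<longleftrightarrow> path \<gamma> \<and>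
     (\<exists>(m::nat) t. t 0 = 0 \<and> t m = (1::real) \<and>
        (\<forall>i<m. t i < t (Suc i) \<and>
           (\<exists>a b. \<forall>s\<in>{t i..t (Suc i)}. \<gamma> s = a + s *\<^sub>R b)))"

text \<open>The integral of \<open>g\<close> along \<open>\<gamma>\<close> with respect to Euclidean length; the norm of
  \<open>real^'n\<close> is the Euclidean one.\<close>

definition length_integral :: "(real \<Rightarrow> real^'n) \<Rightarrow> (real^'n \<Rightarrow> real) \<Rightarrow> real" where
  "length_integral \<gamma> g =
     (LINT t:{0..1}|lborel. g (\<gamma> t) * norm (vector_derivative \<gamma> (at t)))"

text \<open>Here \<open>\<phi>\<close> is one realization of the field.\<close>

definition pseudometric ::
    "(real \<Rightarrow> real) \<Rightarrow> real \<Rightarrow> (real^'n \<Rightarrow> real) \<Rightarrow> (real^'n) set \<Rightarrow> (real^'n) set \<Rightarrow> real" where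
  "pseudometric \<psi> l \<phi> A B =
     Inf {length_integral \<gamma> (\<lambda>y. \<psi> (\<phi> y + l)) | \<gamma>.
            piecewise_affine_path \<gamma> \<and> pathstart \<gamma> \<in> A \<and> pathfinish \<gamma> \<in> B}"

text \<open>The variance is taken in the completed probability space, since an infimum over
  uncountably many paths is a priori measurable only up to null sets. For nonnegative \<open>X\<close> a
  positive value is never an artefact of the integral being zero on non-integrable
  functions.\<close>

definition Var :: "'w measure \<Rightarrow> ('w \<Rightarrow> real) \<Rightarrow> real" where
  "Var M X = prob_space.variance (completion M) X"

end

theory Submission
  imports Defs
begin

text \<open>A single standard normal coordinate of the white noise already makes \<open>T(0,x)\<close> fluctuate, by an
  amount that depends only on the field near the origin. Fix a bounded positive function \<open>g\<close> of
  \<open>L\<^sup>2\<close> norm 1, let \<open>\<xi> = W g\<close>, and let \<open>h(x) = \<integral> q(x - u) g(u) du\<close> be the covariance of \<open>f(x)\<close>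
  and \<open>\<xi>\<close>. Because \<open>q \<ge> 0\<close> and \<open>\<integral> q > 0\<close>, the function \<open>h\<close> is positive everywhere
  (\<open>convolution_pos\<close>); it is also continuous (\<open>convolution_continuous\<close>). The residual field
  \<open>f - \<xi> h\<close> is uncorrelated with \<open>\<xi>\<close>, hence independent of it, so replacing \<open>\<xi>\<close> by an independent
  standard normal \<open>s\<close> does not change the law of the field (\<open>resampled_field_law\<close>).

  For a fixed residual, \<open>T(0,x)\<close> is nondecreasing in \<open>s\<close>. With probability at least \<open>1/2\<close> the
  residual is bounded by some \<open>K\<close> on the closed unit ball. Then there are \<open>s1\<close> and \<open>s2\<close>, depending
  on \<open>K\<close>, \<open>l\<close> and the minimum of \<open>h\<close> over the ball but not on \<open>x\<close>, such that on the ball the field plus \<open>l\<close>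
  is at most \<open>0\<close> for \<open>s \<le> s1\<close> and at least \<open>1\<close> for \<open>s \<ge> s2\<close>. The integrand vanishes there in the
  first case and is at least \<open>\<delta> = \<psi> 1 > 0\<close> in the second. Every path from \<open>0\<close> to \<open>x\<close> has length
  at least \<open>1\<close> inside the ball, so the two values of \<open>T(0,x)\<close> differ by at least \<open>\<delta>\<close>
  (\<open>passage_gap\<close>). Whatever the mean of \<open>T(0,x)\<close> is, given the residual it is missed by
  \<open>\<delta> / 2\<close> with probability at least \<open>p = min (P (s \<le> s1)) (P (s \<ge> s2))\<close>, up to replacing the two
  half-lines by unit intervals. This gives the bound \<open>(\<delta> / 2)\<^sup>2 * (p / 2)\<close> for the variance.

  Three points need care. First, \<open>T(0,x)\<close> is an infimum over uncountably many paths, and \<open>\<psi>\<close> may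
  jump, so that a small displacement of a path can change its cost abruptly. For a countable dense set
  \<open>D\<close>, the infimum \<open>T\<^sub>D\<close> over polygons with inner vertices in \<open>D\<close> is measurable, and
  \<open>T\<^sub>D(\<phi> + s h) \<le> T(\<phi> + s' h) \<le> T\<^sub>D(\<phi> + s' h)\<close> for \<open>s < s'\<close>. The two infima therefore agree at
  every \<open>s\<close> where the monotone function \<open>s \<mapsto> T\<^sub>D(\<phi> + s h)\<close> is continuous, that is, for all but
  countably many \<open>s\<close>, hence almost surely (\<open>AE_pseudometric_eq_passage\<close>). Secondly, the Bochner
  integral of a function that is not integrable is \<open>0\<close>, so the lower bound requires
  a finite second moment; it comes from the straight segment and the linear growth of \<open>\<psi>\<close>
  (\<open>integrable_passage_square\<close>). Thirdly, independence of the residual and \<open>\<xi>\<close> rests on a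
  Cramer-Wold theorem for processes (\<open>cramer_wold_process\<close>), which is derived from the uniqueness
  theorem for characteristic functions on the line.\<close>

section \<open>Processes with equal laws of all linear combinations\<close>

lemma expectation_iexp_of_cos:
  fixes u X :: "'a \<Rightarrow> real"
  assumes "finite_measure M" and [measurable]: "u \<in> borel_measurable M" "X \<in> borel_measurable M"
    and bnd: "\<And>\<omega>. \<bar>u \<omega>\<bar> \<le> B"
  shows "(CLINT \<omega>|M. complex_of_real (u \<omega>) * iexp (X \<omega>)) =
    complex_of_real (LINT \<omega>|M. u \<omega> * cos (X \<omega> + 0)) +
    \<i> * complex_of_real (LINT \<omega>|M. u \<omega> * cos (X \<omega> + - (pi / 2)))"
proof -
  interpret finite_measure M by fact
  have int: "integrable M (\<lambda>\<omega>. u \<omega> * cos (X \<omega> + \<eta>))" for \<eta>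
  proof (rule integrable_const_bound[where B = B])
    show "AE \<omega> in M. norm (u \<omega> * cos (X \<omega> + \<eta>)) \<le> B"
      using bnd by (intro AE_I2)
        (metis abs_mult abs_cos_le_one abs_ge_zero mult_left_le order.trans real_norm_def)
  qed measurable
  have "(CLINT \<omega>|M. complex_of_real (u \<omega>) * iexp (X \<omega>)) =
      (CLINT \<omega>|M. complex_of_real (u \<omega> * cos (X \<omega> + 0)) +
        \<i> * complex_of_real (u \<omega> * cos (X \<omega> + - (pi / 2))))"
    by (intro Bochner_Integration.integral_cong refl)
      (simp add: cos_diff flip: cis_conv_exp, simp add: complex_eq_iff)
  also have "\<dots> = complex_of_real (LINT \<omega>|M. u \<omega> * cos (X \<omega> + 0)) +
    \<i> * complex_of_real (LINT \<omega>|M. u \<omega> * cos (X \<omega> + - (pi / 2)))"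
    using int[of 0] int[of "- (pi/2)"]
    by (subst Bochner_Integration.integral_add)
      (simp_all only: integral_mult_right_zero integral_complex_of_real
        integrable_mult_right integrable_of_real)
  finally show ?thesis .
qed

text \<open>The measures with densities \<open>u\<close> and \<open>v\<close>, pushed forward by \<open>X\<close> and \<open>Y\<close>, have the same
  characteristic function up to their common total mass. Admitting weights is what
  allows one coordinate of a process to be treated at a time.\<close>

lemma weighted_law_uniqueness:
  fixes u X :: "'a \<Rightarrow> real" and v Y :: "'b \<Rightarrow> real"
  assumes M: "prob_space M" and N: "prob_space N"
    and [measurable]: "u \<in> borel_measurable M" "X \<in> borel_measurable M"
      "v \<in> borel_measurable N" "Y \<in> borel_measurable N"
    and u: "\<And>\<omega>. 0 \<le> u \<omega>" "\<And>\<omega>. u \<omega> \<le> B" and v: "\<And>\<omega>. 0 \<le> v \<omega>" "\<And>\<omega>. v \<omega> \<le> B"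
    and eq: "\<And>a \<eta>. (LINT \<omega>|M. u \<omega> * cos (a * X \<omega> + \<eta>)) = (LINT \<omega>|N. v \<omega> * cos (a * Y \<omega> + \<eta>))"
    and A [measurable]: "A \<in> sets borel"
  shows "(LINT \<omega>|M. u \<omega> * indicator A (X \<omega>)) = (LINT \<omega>|N. v \<omega> * indicator A (Y \<omega>))"
proof -
  interpret M: prob_space M by fact
  interpret N: prob_space N by fact
  define m where "m = (LINT \<omega>|M. u \<omega>)"
  have m': "m = (LINT \<omega>|N. v \<omega>)"
    using eq[of 0 0] by (simp add: m_def)
  have iu: "integrable M u"
    using u by (intro M.integrable_const_bound[where B = B]) auto
  have iv: "integrable N v"
    using v by (intro N.integrable_const_bound[where B = B]) auto
  have m0: "0 \<le> m" unfolding m_def using u by simp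
  show ?thesis
  proof (cases "m = 0")
    case True
    have "AE \<omega> in M. u \<omega> = 0"
      using True iu u unfolding m_def by (subst (asm) integral_nonneg_eq_0_iff_AE) auto
    then have "(LINT \<omega>|M. u \<omega> * indicator A (X \<omega>)) = (LINT \<omega>|M. 0)"
      by (intro integral_cong_AE) auto
    moreover have "AE \<omega> in N. v \<omega> = 0"
      using True iv v unfolding m' by (subst (asm) integral_nonneg_eq_0_iff_AE) auto
    then have "(LINT \<omega>|N. v \<omega> * indicator A (Y \<omega>)) = (LINT \<omega>|N. 0)"
      by (intro integral_cong_AE) auto
    ultimately show ?thesis by simp
  next
    case False
    with m0 have m: "0 < m" by simp
    define P where "P = distr (density M (\<lambda>\<omega>. ennreal (u \<omega> / m))) borel X"
    define Q where "Q = distr (density N (\<lambda>\<omega>. ennreal (v \<omega> / m))) borel Y"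
    have one_u: "(\<integral>\<^sup>+\<omega>. ennreal (u \<omega> / m) \<partial>M) = 1"
      using iu u m by (subst nn_integral_eq_integral) (auto simp: m_def)
    have one_v: "(\<integral>\<^sup>+\<omega>. ennreal (v \<omega> / m) \<partial>N) = 1"
      using iv v m by (subst nn_integral_eq_integral) (auto simp: m' )
    have pu: "prob_space (density M (\<lambda>\<omega>. ennreal (u \<omega> / m)))"
      by (intro prob_spaceI) (simp add: emeasure_density one_u cong: nn_integral_cong_simp)
    have pv: "prob_space (density N (\<lambda>\<omega>. ennreal (v \<omega> / m)))"
      by (intro prob_spaceI) (simp add: emeasure_density one_v cong: nn_integral_cong_simp)
    have "real_distribution P"
      unfolding P_def by (intro prob_space.real_distribution_distr[OF pu]) simp
    moreover have "real_distribution Q"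
      unfolding Q_def by (intro prob_space.real_distribution_distr[OF pv]) simp
    moreover have "char P = char Q"
    proof
      fix t
      have "char P t = (CLINT \<omega>|M. complex_of_real (u \<omega> / m) * iexp (t * X \<omega>))"
        unfolding char_def P_def using u m
        by (subst integral_distr, simp, simp, subst integral_density) (auto simp: scaleR_conv_of_real)
      also have "\<dots> = (CLINT \<omega>|M. complex_of_real (u \<omega>) * iexp (t * X \<omega>)) / m"
        by simp
      also have "(CLINT \<omega>|M. complex_of_real (u \<omega>) * iexp (t * X \<omega>)) =
          (CLINT \<omega>|N. complex_of_real (v \<omega>) * iexp (t * Y \<omega>))"
        using u v
        by (subst (1 2) expectation_iexp_of_cos[where B = B])
          (auto simp only: eq M.finite_measure_axioms N.finite_measure_axioms abs_of_nonneg
            intro!: borel_measurable_times borel_measurable_const assms(3-6))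
      also have "\<dots> / m = (CLINT \<omega>|N. complex_of_real (v \<omega> / m) * iexp (t * Y \<omega>))"
        by simp
      also have "\<dots> = char Q t"
        unfolding char_def Q_def using v m
        by (subst integral_distr, simp, simp, subst integral_density) (auto simp: scaleR_conv_of_real)
      finally show "char P t = char Q t" .
    qed
    ultimately have "P = Q" by (rule Levy_uniqueness)
    moreover have "(LINT x|P. indicator A x :: real) = (LINT \<omega>|M. u \<omega> * indicator A (X \<omega>)) / m"
      unfolding P_def using u m
      by (subst integral_distr, simp, simp, subst integral_density) auto
    moreover have "(LINT x|Q. indicator A x :: real) = (LINT \<omega>|N. v \<omega> * indicator A (Y \<omega>)) / m"
      unfolding Q_def using v m
      by (subst integral_distr, simp, simp, subst integral_density) auto
    ultimately show ?thesis using m by simp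
  qed
qed

text \<open>Induction over the coordinates that are already localised in a set \<open>A k\<close>. In the step the law of
  \<open>X k\<close> is compared under the nonnegative weight \<open>u * (1 + cos (S c + \<theta>))\<close>, where \<open>u\<close> is the product of
  the indicators treated so far and \<open>S c\<close> is the linear combination with coefficients \<open>c\<close>. The products
  \<open>cos (a * X k + \<eta>) * cos (S c + \<theta>)\<close> are again sums of cosines of linear combinations, so the
  induction hypothesis applies to them.\<close>

lemma cramer_wold_boxes:
  fixes X :: "'i \<Rightarrow> 'a \<Rightarrow> real" and Y :: "'i \<Rightarrow> 'b \<Rightarrow> real"
  assumes M: "prob_space M" and N: "prob_space N"
    and X [measurable]: "\<And>i. X i \<in> borel_measurable M" and Y [measurable]: "\<And>i. Y i \<in> borel_measurable N"
    and J: "finite J"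
    and eq: "\<And>c \<theta>. (LINT \<omega>|M. cos ((\<Sum>j\<in>J. c j * X j \<omega>) + \<theta>)) =
                    (LINT \<omega>|N. cos ((\<Sum>j\<in>J. c j * Y j \<omega>) + \<theta>))"
    and K: "finite K" "K \<subseteq> J" and A: "\<And>k. A k \<in> sets borel"
  shows "(LINT \<omega>|M. (\<Prod>k\<in>K. indicator (A k) (X k \<omega>)) * cos ((\<Sum>j\<in>J. c j * X j \<omega>) + \<theta>)) =
         (LINT \<omega>|N. (\<Prod>k\<in>K. indicator (A k) (Y k \<omega>)) * cos ((\<Sum>j\<in>J. c j * Y j \<omega>) + \<theta>))"
  using K
proof (induction K arbitrary: c \<theta> rule: finite_induct)
  case empty
  then show ?case by (simp add: eq)
next
  case (insert k K)
  interpret M: prob_space M by fact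
  interpret N: prob_space N by fact
  note A [measurable]
  have kJ: "k \<in> J" using insert by simp
  define u where "u \<omega> = (\<Prod>k\<in>K. indicator (A k) (X k \<omega>) :: real)" for \<omega>
  define v where "v \<omega> = (\<Prod>k\<in>K. indicator (A k) (Y k \<omega>) :: real)" for \<omega>
  have u: "0 \<le> u \<omega>" "u \<omega> \<le> 1" for \<omega>
    unfolding u_def by (auto intro!: prod_nonneg prod_le_1)
  have v: "0 \<le> v \<omega>" "v \<omega> \<le> 1" for \<omega>
    unfolding v_def by (auto intro!: prod_nonneg prod_le_1)
  have [measurable]: "u \<in> borel_measurable M" "v \<in> borel_measurable N"
    unfolding u_def v_def by measurable
  define S where "S c \<omega> = (\<Sum>j\<in>J. c j * X j \<omega>)" for c \<omega>
  define S' where "S' c \<omega> = (\<Sum>j\<in>J. c j * Y j \<omega>)" for c \<omega>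
  have [measurable]: "S c \<in> borel_measurable M" "S' c \<in> borel_measurable N" for c
    unfolding S_def S'_def by measurable
  have IH: "(LINT \<omega>|M. u \<omega> * cos (S c \<omega> + \<theta>)) = (LINT \<omega>|N. v \<omega> * cos (S' c \<omega> + \<theta>))" for c \<theta>
    unfolding u_def v_def S_def S'_def using insert by blast
  have le1: "\<bar>w * cos z\<bar> \<le> (1::real)" if "0 \<le> w" "w \<le> 1" for w z :: real
    using that by (metis abs_cos_le_one abs_ge_zero abs_mult abs_of_nonneg mult_le_one)
  have iM: "integrable M (\<lambda>\<omega>. u \<omega> * cos (Z \<omega>))" if [measurable]: "Z \<in> borel_measurable M" for Z
    using le1 u by (intro M.integrable_const_bound[where B = 1]) auto
  have iN: "integrable N (\<lambda>\<omega>. v \<omega> * cos (Z \<omega>))" if [measurable]: "Z \<in> borel_measurable N" for Z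
    using le1 v by (intro N.integrable_const_bound[where B = 1]) auto
  have Sk0: "S ((\<lambda>_. 0)(k := a)) \<omega> = a * X k \<omega>" for a \<omega>
    unfolding S_def using J kJ by (simp add: sum.remove[of J k])
  have Sk: "S (c(k := c k + a)) \<omega> = S c \<omega> + a * X k \<omega>" for c a \<omega>
    unfolding S_def using J kJ by (simp add: sum.remove[of J k] algebra_simps)
  have S'k0: "S' ((\<lambda>_. 0)(k := a)) \<omega> = a * Y k \<omega>" for a \<omega>
    unfolding S'_def using J kJ by (simp add: sum.remove[of J k])
  have S'k: "S' (c(k := c k + a)) \<omega> = S' c \<omega> + a * Y k \<omega>" for c a \<omega>
    unfolding S'_def using J kJ by (simp add: sum.remove[of J k] algebra_simps)
  have cc: "cos (x + \<eta>) * cos (s + \<theta>) = (cos (s + x + (\<theta> + \<eta>)) + cos (s - x + (\<theta> - \<eta>))) / 2"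
    for x \<eta> s \<theta> :: real
    using cos_times_cos[of "s + \<theta>" "x + \<eta>"] by (simp add: algebra_simps)
  have alg: "w * (1 + s) * x = w * x + (w * A / 2 + w * B / 2)"
    if "x * s = (A + B) / 2" for w s x A B :: real
  proof -
    have "w * (1 + s) * x = w * x + w * (x * s)" by (simp add: algebra_simps)
    then show ?thesis unfolding that by (simp add: field_simps)
  qed
  have key: "(LINT \<omega>|M. (u \<omega> * (1 + cos (S c \<omega> + \<theta>))) * indicator (A k) (X k \<omega>)) =
      (LINT \<omega>|N. (v \<omega> * (1 + cos (S' c \<omega> + \<theta>))) * indicator (A k) (Y k \<omega>))" for c \<theta>
  proof (rule weighted_law_uniqueness[OF M N, where B = 2])
    have c1: "0 \<le> 1 + cos z \<and> 1 + cos z \<le> 2" for z :: real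
      using abs_cos_le_one[of z] by linarith
    show "0 \<le> u \<omega> * (1 + cos (S c \<omega> + \<theta>))" for \<omega>
      using u c1 by simp
    show "0 \<le> v \<omega> * (1 + cos (S' c \<omega> + \<theta>))" for \<omega>
      using v c1 by simp
    show "u \<omega> * (1 + cos (S c \<omega> + \<theta>)) \<le> 2" for \<omega>
      using mult_mono[of "u \<omega>" 1 "1 + cos (S c \<omega> + \<theta>)" 2] u[of \<omega>] c1[of "S c \<omega> + \<theta>"] by simp
    show "v \<omega> * (1 + cos (S' c \<omega> + \<theta>)) \<le> 2" for \<omega>
      using mult_mono[of "v \<omega>" 1 "1 + cos (S' c \<omega> + \<theta>)" 2] v[of \<omega>] c1[of "S' c \<omega> + \<theta>"] by simp
    fix a \<eta> :: real
    have "(LINT \<omega>|M. u \<omega> * (1 + cos (S c \<omega> + \<theta>)) * cos (a * X k \<omega> + \<eta>)) =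
        (LINT \<omega>|M. u \<omega> * cos (S ((\<lambda>_. 0)(k := a)) \<omega> + \<eta>) +
          (u \<omega> * cos (S (c(k := c k + a)) \<omega> + (\<theta> + \<eta>)) / 2 +
           u \<omega> * cos (S (c(k := c k + (- a))) \<omega> + (\<theta> - \<eta>)) / 2))"
      unfolding Sk Sk0
    proof (intro Bochner_Integration.integral_cong refl)
      fix \<omega>
      show "u \<omega> * (1 + cos (S c \<omega> + \<theta>)) * cos (a * X k \<omega> + \<eta>) =
         u \<omega> * cos (a * X k \<omega> + \<eta>) +
         (u \<omega> * cos (S c \<omega> + a * X k \<omega> + (\<theta> + \<eta>)) / 2 + u \<omega> * cos (S c \<omega> + - a * X k \<omega> + (\<theta> - \<eta>)) / 2)"
        using alg[OF cc[of "a * X k \<omega>" \<eta> "S c \<omega>" \<theta>]] by simp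
    qed
    also have "\<dots> = (LINT \<omega>|N. v \<omega> * cos (S' ((\<lambda>_. 0)(k := a)) \<omega> + \<eta>) +
          (v \<omega> * cos (S' (c(k := c k + a)) \<omega> + (\<theta> + \<eta>)) / 2 +
           v \<omega> * cos (S' (c(k := c k + (- a))) \<omega> + (\<theta> - \<eta>)) / 2))"
      by (simp add: Bochner_Integration.integral_add Bochner_Integration.integral_divide_zero iM iN IH)
    also have "\<dots> = (LINT \<omega>|N. v \<omega> * (1 + cos (S' c \<omega> + \<theta>)) * cos (a * Y k \<omega> + \<eta>))"
      unfolding S'k S'k0
    proof (intro Bochner_Integration.integral_cong refl)
      fix \<omega>
      show "v \<omega> * cos (a * Y k \<omega> + \<eta>) +
         (v \<omega> * cos (S' c \<omega> + a * Y k \<omega> + (\<theta> + \<eta>)) / 2 + v \<omega> * cos (S' c \<omega> + - a * Y k \<omega> + (\<theta> - \<eta>)) / 2)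
         = v \<omega> * (1 + cos (S' c \<omega> + \<theta>)) * cos (a * Y k \<omega> + \<eta>)"
        using alg[OF cc[of "a * Y k \<omega>" \<eta> "S' c \<omega>" \<theta>]] by simp
    qed
    finally show "(LINT \<omega>|M. u \<omega> * (1 + cos (S c \<omega> + \<theta>)) * cos (a * X k \<omega> + \<eta>)) =
        (LINT \<omega>|N. v \<omega> * (1 + cos (S' c \<omega> + \<theta>)) * cos (a * Y k \<omega> + \<eta>))" .
  qed measurable
  \<comment> \<open>With zero coefficients and phase the weight is \<open>2 u\<close>; subtracting this case from the
    general one isolates the cosine.\<close>
  have two: "(LINT \<omega>|M. u \<omega> * indicator (A k) (X k \<omega>)) = (LINT \<omega>|N. v \<omega> * indicator (A k) (Y k \<omega>))"
    using key[of "\<lambda>_. 0" 0] by (simp add: S_def S'_def mult.assoc mult.left_commute[of _ 2])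
  have iM1: "integrable M (\<lambda>\<omega>. u \<omega> * indicator (A k) (X k \<omega>) * cos (Z \<omega>))"
    if [measurable]: "Z \<in> borel_measurable M" for Z
    using le1 u by (intro M.integrable_const_bound[where B = 1]) (auto simp: indicator_def)
  have iN1: "integrable N (\<lambda>\<omega>. v \<omega> * indicator (A k) (Y k \<omega>) * cos (Z \<omega>))"
    if [measurable]: "Z \<in> borel_measurable N" for Z
    using le1 v by (intro N.integrable_const_bound[where B = 1]) (auto simp: indicator_def)
  have "(LINT \<omega>|M. u \<omega> * indicator (A k) (X k \<omega>) * cos (S c \<omega> + \<theta>)) =
      (LINT \<omega>|M. (u \<omega> * (1 + cos (S c \<omega> + \<theta>))) * indicator (A k) (X k \<omega>)) -
      (LINT \<omega>|M. u \<omega> * indicator (A k) (X k \<omega>))"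
    using iM1[of "\<lambda>_. 0"] iM1[of "\<lambda>\<omega>. S c \<omega> + \<theta>"] by (simp add: algebra_simps)
  also have "\<dots> = (LINT \<omega>|N. v \<omega> * indicator (A k) (Y k \<omega>) * cos (S' c \<omega> + \<theta>))"
    unfolding key two
    using iN1[of "\<lambda>_. 0"] iN1[of "\<lambda>\<omega>. S' c \<omega> + \<theta>"] by (simp add: algebra_simps)
  finally show ?case
    using insert.hyps by (simp add: u_def v_def S_def S'_def mult_ac)
qed

text \<open>Cramer-Wold theorem for processes. Allowing an arbitrary phase \<open>\<theta>\<close> in the cosine encodes the real and
  the imaginary part of the characteristic function at once.\<close>

theorem cramer_wold_process:
  fixes X :: "'i \<Rightarrow> 'a \<Rightarrow> real" and Y :: "'i \<Rightarrow> 'b \<Rightarrow> real"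
  assumes M: "prob_space M" and N: "prob_space N"
    and X [measurable]: "\<And>i. X i \<in> borel_measurable M" and Y [measurable]: "\<And>i. Y i \<in> borel_measurable N"
    and eq: "\<And>J c \<theta>. finite J \<Longrightarrow> (LINT \<omega>|M. cos ((\<Sum>j\<in>J. c j * X j \<omega>) + \<theta>)) =
                    (LINT \<omega>|N. cos ((\<Sum>j\<in>J. c j * Y j \<omega>) + \<theta>))"
  shows "distr M (\<Pi>\<^sub>M i\<in>UNIV. borel) (\<lambda>\<omega> i. X i \<omega>) = distr N (\<Pi>\<^sub>M i\<in>UNIV. borel) (\<lambda>\<omega> i. Y i \<omega>)"
    (is "?P = ?Q")
proof -
  interpret M: prob_space M by fact
  interpret N: prob_space N by fact
  have mX [measurable]: "(\<lambda>\<omega> i. X i \<omega>) \<in> measurable M (\<Pi>\<^sub>M i\<in>UNIV. borel)"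
    by (intro measurable_PiM_single') (auto simp: X)
  have mY [measurable]: "(\<lambda>\<omega> i. Y i \<omega>) \<in> measurable N (\<Pi>\<^sub>M i\<in>UNIV. borel)"
    by (intro measurable_PiM_single') (auto simp: Y)
  interpret P: prob_space ?P by (rule M.prob_space_distr) simp
  show ?thesis
  proof (rule measure_eqI_PiM_infinite)
    show "finite_measure ?P" by unfold_locales
    fix A :: "'i \<Rightarrow> real set" and J :: "'i set"
    assume J: "finite J" "J \<subseteq> UNIV" and A0: "\<And>i. i \<in> J \<Longrightarrow> A i \<in> sets borel"
    define B where "B i = (if i \<in> J then A i else UNIV)" for i
    have B [measurable]: "B i \<in> sets borel" for i
      using A0 by (simp add: B_def)
    let ?E = "prod_emb UNIV (\<lambda>_. borel) J (Pi\<^sub>E J A) :: ('i \<Rightarrow> real) set"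
    have E: "?E = {x. \<forall>k\<in>J. x k \<in> B k}"
      by (auto simp: prod_emb_def B_def PiE_iff extensional_def)
    have ind: "indicator ?E x = (\<Prod>k\<in>J. indicator (B k) (x k) :: real)" for x :: "'i \<Rightarrow> real"
      using J(1) unfolding E by (cases "\<forall>k\<in>J. x k \<in> B k") (auto simp: indicator_def prod_zero_iff)
    have [measurable]: "?E \<in> sets (\<Pi>\<^sub>M i\<in>UNIV. borel)"
      using A0 J by (intro sets_PiM_I) auto
    have "measure ?P ?E = (LINT x|?P. indicator ?E x)" by simp
    also have "\<dots> = (LINT \<omega>|M. indicator ?E (\<lambda>i. X i \<omega>))"
      by (subst integral_distr) auto
    also have "\<dots> = (LINT \<omega>|N. indicator ?E (\<lambda>i. Y i \<omega>))"
      using cramer_wold_boxes[OF M N X Y J(1) eq[OF J(1)] J(1) order_refl B, where c = "\<lambda>_. 0" and \<theta> = 0]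
      by (simp add: ind)
    also have "\<dots> = (LINT x|?Q. indicator ?E x)"
      by (subst integral_distr) auto
    also have "\<dots> = measure ?Q ?E" by simp
    finally show "emeasure ?P ?E = emeasure ?Q ?E"
      using N.finite_measure_axioms
      by (simp add: P.emeasure_eq_measure finite_measure.emeasure_eq_measure finite_measure.finite_measure_distr)
  qed auto
qed

section \<open>Resampling one coordinate of the white noise\<close>

lemma std_normal_cos:
  "(LINT s|std_normal_distribution. cos (a * s + \<theta>)) = exp (- a\<^sup>2 / 2) * cos \<theta>"
proof -
  interpret real_distribution std_normal_distribution by (rule real_dist_normal_dist)
  have int: "integrable std_normal_distribution (\<lambda>s. iexp (a * s))"
    by (intro integrable_const_bound[where B = 1]) auto
  have "(LINT s|std_normal_distribution. cos (a * s + \<theta>)) =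
      (LINT s|std_normal_distribution. Re (iexp (a * s) * cis \<theta>))"
    by (intro Bochner_Integration.integral_cong refl) (simp add: cos_add del: of_real_mult flip: cis_conv_exp)
  also have "\<dots> = Re ((CLINT s|std_normal_distribution. iexp (a * s)) * cis \<theta>)"
    using int by (subst integral_Re) auto
  also have "(CLINT s|std_normal_distribution. iexp (a * s)) = complex_of_real (exp (- a\<^sup>2 / 2))"
    using fun_cong[OF char_std_normal_distribution, of a] by (simp add: char_def)
  finally show ?thesis by simp
qed

text \<open>The formula for the characteristic function holds for degenerate variables too, which is
  why it is stated through the second moment and not through a density.\<close>

lemma gaussian_rv_centered:
  assumes "prob_space M" and X: "gaussian_rv M X" and m: "(LINT \<omega>|M. X \<omega>) = 0"
  shows "integrable M (\<lambda>\<omega>. (X \<omega>)\<^sup>2)"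
    and "(LINT \<omega>|M. cos (X \<omega> + \<theta>)) = exp (- (LINT \<omega>|M. (X \<omega>)\<^sup>2) / 2) * cos \<theta>"
proof -
  interpret prob_space M by fact
  have [measurable]: "X \<in> borel_measurable M" using X by (simp add: gaussian_rv_def)
  have "integrable M (\<lambda>\<omega>. (X \<omega>)\<^sup>2) \<and>
    (LINT \<omega>|M. cos (X \<omega> + \<theta>)) = exp (- (LINT \<omega>|M. (X \<omega>)\<^sup>2) / 2) * cos \<theta>"
    using X unfolding gaussian_rv_def
  proof (elim conjE disjE exE)
    fix \<mu> assume ae: "AE \<omega> in M. X \<omega> = \<mu>"
    have "(LINT \<omega>|M. X \<omega>) = (LINT \<omega>|M. \<mu>)" using ae by (intro integral_cong_AE) auto
    then have "\<mu> = 0" using m by (simp add: prob_space)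
    with ae have ae: "AE \<omega> in M. X \<omega> = 0" by simp
    have "integrable M (\<lambda>\<omega>. (X \<omega>)\<^sup>2) \<longleftrightarrow> integrable M (\<lambda>\<omega>. 0::real)"
      using ae by (intro integrable_cong_AE) auto
    moreover have "(LINT \<omega>|M. (X \<omega>)\<^sup>2) = (LINT \<omega>|M. 0)" using ae by (intro integral_cong_AE) auto
    moreover have "(LINT \<omega>|M. cos (X \<omega> + \<theta>)) = (LINT \<omega>|M. cos \<theta>)" using ae by (intro integral_cong_AE) auto
    ultimately show ?thesis by (simp add: prob_space)
  next
    fix \<mu> \<sigma> :: real assume s: "0 < \<sigma>" and D: "distributed M lborel X (normal_density \<mu> \<sigma>)"
    have mu: "\<mu> = 0" using normal_distributed_expectation[OF s D] m by simp
    have v: "(LINT \<omega>|M. (X \<omega>)\<^sup>2) = \<sigma>\<^sup>2"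
      using normal_distributed_variance[OF s D] m by simp
    have int: "integrable M (\<lambda>\<omega>. (X \<omega>)\<^sup>2)"
      using integrable_normal_moment[OF s, of \<mu> 2] distributed_integrable[OF D, of "\<lambda>x. x\<^sup>2"]
      by (simp add: mu)
    have "distributed M lborel (\<lambda>\<omega>. (X \<omega> - \<mu>) / \<sigma>) std_normal_density"
      using D s by (subst (asm) normal_standard_normal_convert) auto
    then have Z: "distributed M lborel (\<lambda>\<omega>. X \<omega> / \<sigma>) std_normal_density"
      by (simp add: mu)
    have "distr M borel (\<lambda>\<omega>. X \<omega> / \<sigma>) = std_normal_distribution"
      using distributed_distr_eq_density[OF Z] by (simp cong: distr_cong)
    then have "(LINT s|std_normal_distribution. cos (\<sigma> * s + \<theta>)) =
        (LINT s|distr M borel (\<lambda>\<omega>. X \<omega> / \<sigma>). cos (\<sigma> * s + \<theta>))" by simp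
    also have "\<dots> = (LINT \<omega>|M. cos (X \<omega> + \<theta>))"
      using s by (subst integral_distr) auto
    finally show ?thesis using int v by (simp add: std_normal_cos)
  qed
  then show "integrable M (\<lambda>\<omega>. (X \<omega>)\<^sup>2)"
    and "(LINT \<omega>|M. cos (X \<omega> + \<theta>)) = exp (- (LINT \<omega>|M. (X \<omega>)\<^sup>2) / 2) * cos \<theta>" by auto
qed

lemma integrable_mult_of_squares:
  fixes X Y :: "'a \<Rightarrow> real"
  assumes [measurable]: "X \<in> borel_measurable M" "Y \<in> borel_measurable M"
    and "integrable M (\<lambda>\<omega>. (X \<omega>)\<^sup>2)" "integrable M (\<lambda>\<omega>. (Y \<omega>)\<^sup>2)"
  shows "integrable M (\<lambda>\<omega>. X \<omega> * Y \<omega>)"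
proof (rule Bochner_Integration.integrable_bound)
  show "integrable M (\<lambda>\<omega>. (X \<omega>)\<^sup>2 + (Y \<omega>)\<^sup>2)" using assms by simp
  have "\<bar>a * b\<bar> \<le> a\<^sup>2 + b\<^sup>2" for a b :: real
  proof -
    have "2 * \<bar>a\<bar> * \<bar>b\<bar> \<le> a\<^sup>2 + b\<^sup>2"
      using sum_squares_bound[of "\<bar>a\<bar>" "\<bar>b\<bar>"] by simp
    moreover have "0 \<le> \<bar>a\<bar> * \<bar>b\<bar>" by simp
    ultimately show ?thesis unfolding abs_mult by linarith
  qed
  then show "AE \<omega> in M. norm (X \<omega> * Y \<omega>) \<le> norm ((X \<omega>)\<^sup>2 + (Y \<omega>)\<^sup>2)" by simp
qed measurable

lemma white_noise_gaussian_rv: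
  assumes "white_noise M W" "square_integrable g"
  shows "gaussian_rv M (W g)"
proof -
  have "gaussian_rv M (\<lambda>\<omega>. \<Sum>j\<in>{g}. 1 * W j \<omega>)"
    using assms unfolding white_noise_def gaussian_process_def
    by (elim conjE allE[of _ "{g}"]) (auto dest: spec[of _ "\<lambda>_. 1"])
  then show ?thesis by simp
qed

text \<open>The functions \<open>g k\<close> may coincide for different indices, whereas a Gaussian process is only
  tested on combinations over sets of functions; coefficients of equal functions are added first.\<close>

lemma white_noise_linear_combination:
  fixes W :: "(real^'n \<Rightarrow> real) \<Rightarrow> 'w \<Rightarrow> real"
  assumes M: "prob_space M" and W: "white_noise M W"
    and K: "finite K" and g: "\<And>k. k \<in> K \<Longrightarrow> square_integrable (g k)"
  shows "(LINT \<omega>|M. cos ((\<Sum>k\<in>K. a k * W (g k) \<omega>) + \<theta>)) =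
    exp (- (\<Sum>k\<in>K. \<Sum>l\<in>K. a k * a l * (LINT u|lborel. g k u * g l u)) / 2) * cos \<theta>"
proof -
  interpret prob_space M by fact
  note gk = white_noise_gaussian_rv[OF W g]
  have mean: "(LINT \<omega>|M. W (g k) \<omega>) = 0" if "k \<in> K" for k
    using W g[OF that] by (simp add: white_noise_def)
  have meas: "W (g k) \<in> borel_measurable M" if "k \<in> K" for k
    using gk[OF that] by (simp add: gaussian_rv_def)
  have sq: "integrable M (\<lambda>\<omega>. (W (g k) \<omega>)\<^sup>2)" if "k \<in> K" for k
    by (rule gaussian_rv_centered(1)[OF M gk mean]) fact+
  have int: "integrable M (W (g k))" if "k \<in> K" for k
    using square_integrable_imp_integrable[OF meas sq] that by simp
  let ?S = "\<lambda>\<omega>. \<Sum>k\<in>K. a k * W (g k) \<omega>"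
  have "gaussian_rv M (\<lambda>\<omega>. \<Sum>y\<in>g ` K. (\<Sum>k | k \<in> K \<and> g k = y. a k) * W y \<omega>)"
    using W K g unfolding white_noise_def gaussian_process_def
    by (elim conjE allE[of _ "g ` K"])
      (auto dest!: spec[of _ "\<lambda>y. \<Sum>k | k \<in> K \<and> g k = y. a k"])
  also have "(\<lambda>\<omega>. \<Sum>y\<in>g ` K. (\<Sum>k | k \<in> K \<and> g k = y. a k) * W y \<omega>) = ?S"
    using K by (intro ext) (auto simp: sum.image_gen[of K _ g] sum_distrib_right intro!: sum.cong)
  finally have G: "gaussian_rv M ?S" .
  have "(LINT \<omega>|M. ?S \<omega>) = 0"
    using int mean by (subst Bochner_Integration.integral_sum) auto
  from gaussian_rv_centered(2)[OF M G this]
  have "(LINT \<omega>|M. cos (?S \<omega> + \<theta>)) = exp (- (LINT \<omega>|M. (?S \<omega>)\<^sup>2) / 2) * cos \<theta>" .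
  also have "(LINT \<omega>|M. (?S \<omega>)\<^sup>2) =
      (LINT \<omega>|M. (\<Sum>k\<in>K. \<Sum>l\<in>K. a k * a l * (W (g k) \<omega> * W (g l) \<omega>)))"
    by (intro Bochner_Integration.integral_cong refl)
      (simp add: power2_eq_square sum_product mult_ac)
  also have "\<dots> = (\<Sum>k\<in>K. \<Sum>l\<in>K. a k * a l * (LINT \<omega>|M. W (g k) \<omega> * W (g l) \<omega>))"
    using integrable_mult_of_squares[OF meas meas sq sq]
    by (subst Bochner_Integration.integral_sum, force)
      (intro sum.cong refl, subst Bochner_Integration.integral_sum, auto)
  also have "\<dots> = (\<Sum>k\<in>K. \<Sum>l\<in>K. a k * a l * (LINT u|lborel. g k u * g l u))"
    using W g by (intro sum.cong refl) (simp add: white_noise_def)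
  finally show ?thesis .
qed

text \<open>Since \<open>h x\<close> is the covariance of \<open>f x\<close> and \<open>W g\<close>, the residual \<open>f x - W g * h x\<close> is
  uncorrelated with \<open>W g\<close>. For a linear combination with variance \<open>Q\<close> and with \<open>H = \<Sum> c x * h x\<close>, the
  residual part has variance \<open>Q - H\<^sup>2\<close> and the independent normal variable contributes \<open>H\<^sup>2\<close>
  again, so all linear combinations keep their law.\<close>

theorem resampled_field_law:
  fixes W :: "(real^'n \<Rightarrow> real) \<Rightarrow> 'w \<Rightarrow> real"
  assumes M: "prob_space M" and W: "white_noise M W" and f: "moving_average M W q f"
    and fm [measurable]: "\<And>x. f x \<in> borel_measurable M"
    and q: "\<And>x. square_integrable (\<lambda>u. q (x - u))"
    and g: "square_integrable g" and g1: "(LINT u|lborel. g u * g u) = 1"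
    and h: "\<And>x. h x = (LINT u|lborel. q (x - u) * g u)"
  shows "distr M (\<Pi>\<^sub>M x\<in>UNIV. borel) (\<lambda>\<omega> x. f x \<omega>) =
    distr (M \<Otimes>\<^sub>M std_normal_distribution) (\<Pi>\<^sub>M x\<in>UNIV. borel)
      (\<lambda>z x. f x (fst z) - W g (fst z) * h x + snd z * h x)"
proof -
  interpret prob_space M by fact
  interpret N: real_distribution std_normal_distribution by (rule real_dist_normal_dist)
  interpret P: pair_prob_space M std_normal_distribution ..
  have [measurable]: "W g \<in> borel_measurable M"
    using white_noise_gaussian_rv[OF W g] by (simp add: gaussian_rv_def)
  show ?thesis
  proof (rule cramer_wold_process[OF M P.prob_space_axioms])
    fix J :: "(real^'n) set" and c :: "real^'n \<Rightarrow> real" and \<theta> :: real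
    assume J: "finite J"
    let ?q = "\<lambda>x u. q (x - u)"
    define Q where "Q = (\<Sum>x\<in>J. \<Sum>y\<in>J. c x * c y * (LINT u|lborel. ?q x u * ?q y u))"
    define H where "H = (\<Sum>x\<in>J. c x * h x)"
    have ae: "AE \<omega> in M. \<forall>x\<in>J. f x \<omega> = W (?q x) \<omega>"
      using J f by (intro AE_finite_allI) (auto simp: moving_average_def)
    have Wm [measurable]: "W (?q x) \<in> borel_measurable M" for x
      using white_noise_gaussian_rv[OF W q] by (simp add: gaussian_rv_def)
    have "(LINT \<omega>|M. cos ((\<Sum>x\<in>J. c x * f x \<omega>) + \<theta>)) =
        (LINT \<omega>|M. cos ((\<Sum>x\<in>J. c x * W (?q x) \<omega>) + \<theta>))"
      using ae by (intro integral_cong_AE) auto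
    also have "\<dots> = exp (- Q / 2) * cos \<theta>"
      unfolding Q_def by (rule white_noise_linear_combination[OF M W J]) (rule q)
    finally have L: "(LINT \<omega>|M. cos ((\<Sum>x\<in>J. c x * f x \<omega>) + \<theta>)) = exp (- Q / 2) * cos \<theta>" .
    have inner: "(LINT \<omega>|M. cos ((\<Sum>x\<in>J. c x * (f x \<omega> - W g \<omega> * h x)) + \<eta>)) =
        exp (- (Q - H\<^sup>2) / 2) * cos \<eta>" for \<eta>
    proof -
      \<comment> \<open>The index \<open>None\<close> stands for \<open>g\<close>, which enters with coefficient \<open>- H\<close>.\<close>
      define K where "K = insert None (Some ` J)"
      define a where "a = case_option (- H) c"
      define G where "G = case_option g ?q"
      have sumK: "(\<Sum>k\<in>K. F k) = F None + (\<Sum>x\<in>J. F (Some x))" for F :: "(real^'n) option \<Rightarrow> real"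
        unfolding K_def using J by (simp add: sum.reindex image_iff)
      have "(LINT \<omega>|M. cos ((\<Sum>x\<in>J. c x * (f x \<omega> - W g \<omega> * h x)) + \<eta>)) =
          (LINT \<omega>|M. cos ((\<Sum>k\<in>K. a k * W (G k) \<omega>) + \<eta>))"
      proof (rule integral_cong_AE)
        show "AE \<omega> in M. cos ((\<Sum>x\<in>J. c x * (f x \<omega> - W g \<omega> * h x)) + \<eta>) =
            cos ((\<Sum>k\<in>K. a k * W (G k) \<omega>) + \<eta>)"
          using ae
        proof eventually_elim
          case (elim \<omega>)
          have "(\<Sum>x\<in>J. c x * (f x \<omega> - W g \<omega> * h x)) =
              (\<Sum>x\<in>J. c x * W (?q x) \<omega>) - (\<Sum>x\<in>J. (c x * h x) * W g \<omega>)"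
            unfolding sum_subtractf[symmetric] using elim
            by (intro sum.cong refl) (simp add: algebra_simps)
          then show ?case
            by (simp add: sumK a_def G_def H_def sum_distrib_right)
        qed
        show "(\<lambda>\<omega>. cos ((\<Sum>k\<in>K. a k * W (G k) \<omega>) + \<eta>)) \<in> borel_measurable M"
          unfolding sumK by (simp add: a_def G_def)
      qed measurable
      also have "\<dots> = exp (- (\<Sum>k\<in>K. \<Sum>l\<in>K. a k * a l * (LINT u|lborel. G k u * G l u)) / 2) * cos \<eta>"
        using J g q
        by (intro white_noise_linear_combination[OF M W]) (auto simp: K_def G_def)
      also have "(\<Sum>k\<in>K. \<Sum>l\<in>K. a k * a l * (LINT u|lborel. G k u * G l u)) =
          H\<^sup>2 + (\<Sum>x\<in>J. - (H * c x * h x)) + ((\<Sum>x\<in>J. - (H * c x * h x)) + Q)"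
        unfolding sumK sum.distrib
        by (simp add: a_def G_def g1 Q_def h power2_eq_square mult_ac)
      also have "(\<Sum>x\<in>J. - (H * c x * h x)) = - H\<^sup>2"
        by (simp add: H_def power2_eq_square sum_distrib_left sum_negf mult.assoc)
      finally show ?thesis by simp
    qed
    have "(LINT z|(M \<Otimes>\<^sub>M std_normal_distribution).
          cos ((\<Sum>x\<in>J. c x * (f x (fst z) - W g (fst z) * h x + snd z * h x)) + \<theta>)) =
        (LINT z|(M \<Otimes>\<^sub>M std_normal_distribution).
          (case z of (\<omega>, s) \<Rightarrow> cos ((\<Sum>x\<in>J. c x * (f x \<omega> - W g \<omega> * h x)) + (H * s + \<theta>))))"
    proof (intro Bochner_Integration.integral_cong refl)
      fix z :: "'w \<times> real"
      have "(\<Sum>x\<in>J. c x * (f x (fst z) - W g (fst z) * h x + snd z * h x)) =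
          (\<Sum>x\<in>J. c x * (f x (fst z) - W g (fst z) * h x)) + H * snd z"
        unfolding H_def sum_distrib_right sum.distrib[symmetric]
        by (intro sum.cong refl) (simp add: algebra_simps)
      then show "cos ((\<Sum>x\<in>J. c x * (f x (fst z) - W g (fst z) * h x + snd z * h x)) + \<theta>) =
          (case z of (\<omega>, s) \<Rightarrow> cos ((\<Sum>x\<in>J. c x * (f x \<omega> - W g \<omega> * h x)) + (H * s + \<theta>)))"
        by (simp add: split_beta add.assoc)
    qed
    also have "\<dots> = (LINT s|std_normal_distribution. LINT \<omega>|M.
        cos ((\<Sum>x\<in>J. c x * (f x \<omega> - W g \<omega> * h x)) + (H * s + \<theta>)))"
      by (rule P.integral_snd[symmetric]) (intro P.integrable_const_bound[where B = 1], auto)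
    also have "\<dots> = exp (- (Q - H\<^sup>2) / 2) * (exp (- H\<^sup>2 / 2) * cos \<theta>)"
      by (simp only: inner integral_mult_right_zero std_normal_cos)
    also have "\<dots> = exp (- Q / 2) * cos \<theta>"
      using exp_add[of "- (Q - H\<^sup>2) / 2" "- H\<^sup>2 / 2"] by (simp add: field_simps)
    finally show "(LINT \<omega>|M. cos ((\<Sum>x\<in>J. c x * f x \<omega>) + \<theta>)) =
        (LINT z|(M \<Otimes>\<^sub>M std_normal_distribution).
          cos ((\<Sum>x\<in>J. c x * (f x (fst z) - W g (fst z) * h x + snd z * h x)) + \<theta>))"
      unfolding L by simp
  qed measurable
qed

section \<open>The pseudometric as an infimum over polygons\<close>

text \<open>The integrands \<open>\<psi> (\<phi> y + l)\<close> may be discontinuous, but for continuous \<open>\<phi>\<close> they have this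
  property, which makes all integrals along segments finite.\<close>

definition locally_bounded_borel :: "(real^'n \<Rightarrow> real) \<Rightarrow> bool" where
  "locally_bounded_borel g \<longleftrightarrow> g \<in> borel_measurable borel \<and> (\<forall>r. \<exists>B. \<forall>y\<in>cball 0 r. \<bar>g y\<bar> \<le> B)"

definition segment_cost :: "(real^'n \<Rightarrow> real) \<Rightarrow> real^'n \<Rightarrow> real^'n \<Rightarrow> real" where
  "segment_cost g a b = norm (b - a) * (LINT u:{0..1}|lborel. g (a + u *\<^sub>R (b - a)))"

definition polygon_cost :: "(real^'n \<Rightarrow> real) \<Rightarrow> (real^'n) list \<Rightarrow> real" where
  "polygon_cost g vs = (\<Sum>i<length vs - 1. segment_cost g (vs ! i) (vs ! Suc i))"

lemma set_integrable_on_line: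
  assumes g: "locally_bounded_borel g"
  shows "set_integrable lborel {c..d} (\<lambda>s. g (a + s *\<^sub>R b))"
proof -
  have [measurable]: "g \<in> borel_measurable borel" using g by (simp add: locally_bounded_borel_def)
  have "compact ((\<lambda>s. a + s *\<^sub>R b) ` {c..d})"
    by (intro compact_continuous_image continuous_intros compact_Icc)
  then obtain r where r: "(\<lambda>s. a + s *\<^sub>R b) ` {c..d} \<subseteq> cball 0 r"
    by (metis compact_imp_bounded bounded_iff mem_cball_0 subsetI)
  obtain B where B: "\<And>y. y \<in> cball 0 r \<Longrightarrow> \<bar>g y\<bar> \<le> B"
    using g unfolding locally_bounded_borel_def by blast
  have B': "\<bar>g (a + s *\<^sub>R b)\<bar> \<le> B" if "c \<le> s" "s \<le> d" for s
    using that by (intro B subsetD[OF r] image_eqI[where x = s]) auto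
  show ?thesis unfolding set_integrable_def
    by (rule integrableI_bounded_set_indicator[where B = B]) (use B' in \<open>auto simp: emeasure_lborel_Icc_eq\<close>)
qed

lemma set_integrable_on_open_line:
  assumes "locally_bounded_borel g"
  shows "set_integrable lborel {c<..<d} (\<lambda>s. g (a + s *\<^sub>R b))"
  by (rule set_integrable_subset[OF set_integrable_on_line[OF assms, of c d]]) auto

lemma line_integral_eq_segment_cost:
  assumes "t0 < t1"
  shows "(LINT s:{t0<..<t1}|lborel. g (a + s *\<^sub>R b) * norm b) =
    segment_cost g (a + t0 *\<^sub>R b) (a + t1 *\<^sub>R b)"
proof -
  define c where "c = t1 - t0"
  have c: "c > 0" using assms by (simp add: c_def)
  have d: "(a + t1 *\<^sub>R b) - (a + t0 *\<^sub>R b) = c *\<^sub>R b"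
    by (simp add: c_def algebra_simps)
  have "(LINT s:{t0<..<t1}|lborel. g (a + s *\<^sub>R b) * norm b) =
      norm b * (LINT s:{t0<..<t1}|lborel. g (a + s *\<^sub>R b))"
    by (simp add: set_integral_mult_left mult.commute)
  also have "(LINT s:{t0<..<t1}|lborel. g (a + s *\<^sub>R b)) =
      c * (LINT u|lborel. indicator {t0<..<t1} (t0 + c * u) *\<^sub>R g (a + (t0 + c * u) *\<^sub>R b))"
    unfolding set_lebesgue_integral_def using c
    by (subst lborel_integral_real_affine[where c = c and t = t0]) auto
  also have "(\<lambda>u. indicator {t0<..<t1} (t0 + c * u) *\<^sub>R g (a + (t0 + c * u) *\<^sub>R b)) =
      (\<lambda>u. indicator {0<..<1} u *\<^sub>R g ((a + t0 *\<^sub>R b) + u *\<^sub>R (c *\<^sub>R b)))"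
  proof
    fix u
    have "t1 = t0 + c" by (simp add: c_def)
    then have "t0 + c * u < t1 \<longleftrightarrow> u < 1"
      using c mult_less_cancel_left_pos[of c u 1] by simp
    moreover have "t0 < t0 + c * u \<longleftrightarrow> 0 < u" using c by (simp add: zero_less_mult_iff)
    ultimately have "indicator {t0<..<t1} (t0 + c * u) = (indicator {0<..<1} u :: real)"
      by (simp add: indicator_def)
    then show "indicator {t0<..<t1} (t0 + c * u) *\<^sub>R g (a + (t0 + c * u) *\<^sub>R b) =
        indicator {0<..<1} u *\<^sub>R g ((a + t0 *\<^sub>R b) + u *\<^sub>R (c *\<^sub>R b))"
      by (simp add: algebra_simps)
  qed
  also have "(LINT u|lborel. indicator {0<..<1} u *\<^sub>R g ((a + t0 *\<^sub>R b) + u *\<^sub>R (c *\<^sub>R b))) =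
      (LINT u:{0..1}|lborel. g ((a + t0 *\<^sub>R b) + u *\<^sub>R (c *\<^sub>R b)))"
    unfolding set_lebesgue_integral_def
    by (rule integral_discrete_difference[where X = "{0, 1}"]) (auto simp: indicator_def)
  finally show ?thesis
    unfolding segment_cost_def d using c by simp
qed

lemma partition_mono:
  fixes t :: "nat \<Rightarrow> real"
  assumes "\<And>i. i < m \<Longrightarrow> t i < t (Suc i)" "i \<le> j" "j \<le> m"
  shows "t i \<le> t j"
  using assms(2,3)
proof (induction j rule: dec_induct)
  case (step n)
  then show ?case using assms(1)[of n] by simp
qed simp

lemma partition_covers:
  fixes t :: "nat \<Rightarrow> real"
  shows "{t 0..t k} \<subseteq> t ` {..k} \<union> (\<Union>i<k. {t i<..<t (Suc i)})"
proof (induction k)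
  case (Suc k)
  show ?case
  proof
    fix s assume s: "s \<in> {t 0..t (Suc k)}"
    consider "s \<le> t k" | "t k < s" "s < t (Suc k)" | "s = t (Suc k)" using s by fastforce
    then show "s \<in> t ` {..Suc k} \<union> (\<Union>i<Suc k. {t i<..<t (Suc i)})"
    proof cases
      case 1
      then have "s \<in> {t 0..t k}" using s by simp
      then have "s \<in> t ` {..k} \<union> (\<Union>i<k. {t i<..<t (Suc i)})" using Suc by blast
      then show ?thesis unfolding lessThan_Suc atMost_Suc by blast
    qed (auto simp: lessThan_Suc)
  qed
qed auto

text \<open>Between two consecutive breakpoints the velocity is constant and an affine substitution turns the integral
  into a segment cost, so that the speed of the parametrisation disappears. The finitely many
  breakpoints, where the velocity may not exist, form a null set.\<close>

lemma length_integral_eq_sum: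
  fixes \<gamma> :: "real \<Rightarrow> real^'n"
  assumes g: "locally_bounded_borel g"
    and t: "t 0 = 0" "t m = (1::real)" "\<And>i. i < m \<Longrightarrow> t i < t (Suc i)"
    and aff: "\<And>i. i < m \<Longrightarrow> \<exists>a b. \<forall>s\<in>{t i..t (Suc i)}. \<gamma> s = a + s *\<^sub>R b"
  shows "length_integral \<gamma> g = (\<Sum>i<m. segment_cost g (\<gamma> (t i)) (\<gamma> (t (Suc i))))"
proof -
  let ?F = "\<lambda>s. g (\<gamma> s) * norm (vector_derivative \<gamma> (at s))"
  let ?A = "\<lambda>i. {t i<..<t (Suc i)}"
  have piece: "set_integrable lborel (?A i) ?F \<and>
      (LINT s:?A i|lborel. ?F s) = segment_cost g (\<gamma> (t i)) (\<gamma> (t (Suc i)))" if i: "i < m" for i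
  proof -
    obtain a b where ab: "\<And>s. s \<in> {t i..t (Suc i)} \<Longrightarrow> \<gamma> s = a + s *\<^sub>R b" using aff[OF i] by blast
    have vd: "vector_derivative \<gamma> (at s) = b" if s: "s \<in> ?A i" for s
    proof (rule vector_derivative_at, rule has_vector_derivative_transform_within_open)
      show "((\<lambda>s. a + s *\<^sub>R b) has_vector_derivative b) (at s)"
        by (auto intro!: derivative_eq_intros)
      show "open (?A i)" "s \<in> ?A i" using s by auto
      show "a + y *\<^sub>R b = \<gamma> y" if "y \<in> ?A i" for y using ab[of y] that by auto
    qed
    have eq: "?F s = g (a + s *\<^sub>R b) * norm b" if "s \<in> ?A i" for s
      using ab[of s] vd[OF that] that by auto
    have "set_integrable lborel (?A i) (\<lambda>s. g (a + s *\<^sub>R b) * norm b)"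
      by (intro set_integrable_mult_left impI set_integrable_on_open_line g)
    then have "set_integrable lborel (?A i) ?F"
      by (subst set_integrable_cong[OF refl refl eq]) auto
    moreover have "(LINT s:?A i|lborel. ?F s) = (LINT s:?A i|lborel. g (a + s *\<^sub>R b) * norm b)"
      using eq by (intro set_lebesgue_integral_cong) auto
    moreover have "\<dots> = segment_cost g (a + t i *\<^sub>R b) (a + t (Suc i) *\<^sub>R b)"
      by (rule line_integral_eq_segment_cost) (rule t(3)[OF i])
    ultimately show ?thesis using ab[of "t i"] ab[of "t (Suc i)"] t(3)[OF i] by auto
  qed
  have disj: "disjoint_family_on ?A {..<m}"
  proof (unfold disjoint_family_on_def, intro ballI impI)
    have *: "?A i \<inter> ?A j = {}" if "i < j" "j < m" for i j
      using partition_mono[of m t "Suc i" j] t(3) that by fastforce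
    fix i j assume "i \<in> {..<m}" "j \<in> {..<m}" "i \<noteq> j"
    then show "?A i \<inter> ?A j = {}" using *[of i j] *[of j i] by (cases "i < j") auto
  qed
  have sub: "?A i \<subseteq> {0..1}" if "i < m" for i
    using partition_mono[of m t 0 i] partition_mono[of m t "Suc i" m] t that by auto
  have "length_integral \<gamma> g = (LINT s:(\<Union>i<m. ?A i)|lborel. ?F s)"
    unfolding length_integral_def
  proof (rule set_integral_discrete_difference[where X = "t ` {..m}"])
    show "{0..1} - (\<Union>i<m. ?A i) \<union> ((\<Union>i<m. ?A i) - {0..1}) \<subseteq> t ` {..m}"
      using partition_covers[of t m] sub t by auto
  qed auto
  also have "\<dots> = (\<Sum>i<m. LINT s:?A i|lborel. ?F s)"
    by (rule set_integral_finite_Union) (use disj piece in auto)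
  finally show ?thesis using piece by simp
qed

text \<open>The breakpoints are immaterial for the cost, so any choice serves: each new vertex compresses
  the previous path to \<open>[0, 1/2]\<close> and appends one segment.\<close>

lemma polygon_path_exists:
  fixes v :: "nat \<Rightarrow> real^'n"
  assumes "0 < m"
  shows "\<exists>\<gamma> t. path \<gamma> \<and> t 0 = 0 \<and> t m = (1::real) \<and>
    (\<forall>i<m. t i < t (Suc i) \<and> (\<exists>a b. \<forall>s\<in>{t i..t (Suc i)}. \<gamma> s = a + s *\<^sub>R b)) \<and>
    (\<forall>i\<le>m. \<gamma> (t i) = v i)"
  using assms
proof (induction m rule: nat_induct_non_zero)
  case 1
  show ?case
  proof (intro exI[of _ "linepath (v 0) (v 1)"] exI[of _ real] conjI)
    show "\<forall>i<1. real i < real (Suc i) \<and>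
        (\<exists>a b. \<forall>s\<in>{real i..real (Suc i)}. linepath (v 0) (v 1) s = a + s *\<^sub>R b)"
    proof (intro allI impI conjI exI ballI)
      fix i s assume "i < (1::nat)"
      show "linepath (v 0) (v 1) s = v 0 + s *\<^sub>R (v 1 - v 0)"
        by (simp add: linepath_def algebra_simps)
    qed auto
    show "\<forall>i\<le>1. linepath (v 0) (v 1) (real i) = v i"
      by (auto simp: le_Suc_eq linepath_def)
  qed auto
next
  case (Suc m)
  then obtain \<gamma> t where \<gamma>: "path \<gamma>" and t: "t 0 = 0" "t m = (1::real)"
    and inc: "\<And>i. i < m \<Longrightarrow> t i < t (Suc i)"
    and aff: "\<And>i. i < m \<Longrightarrow> \<exists>a b. \<forall>s\<in>{t i..t (Suc i)}. \<gamma> s = a + s *\<^sub>R b"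
    and v: "\<And>i. i \<le> m \<Longrightarrow> \<gamma> (t i) = v i" by blast
  define d where "d = v (Suc m) - v m"
  define \<gamma>' where "\<gamma>' = \<gamma> +++ linepath (v m) (v (Suc m))"
  define t' where "t' i = (if i \<le> m then t i / 2 else 1)" for i
  have t1: "t i \<le> 1" if "i \<le> m" for i
    using partition_mono[of m t i m] inc that t by auto
  have left: "\<gamma>' s = \<gamma> (2 * s)" if "s \<le> 1 / 2" for s
    using that by (simp add: \<gamma>'_def joinpaths_def)
  have right: "\<gamma>' s = (v m - d) + s *\<^sub>R (2 *\<^sub>R d)" if "1 / 2 \<le> s" for s
  proof (cases "s = 1 / 2")
    case True
    show ?thesis unfolding True using left[of "1 / 2"] v[of m] t by simp
  next
    case False
    then show ?thesis using that
      by (simp add: \<gamma>'_def joinpaths_def linepath_def d_def algebra_simps)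
  qed
  have "path \<gamma>'"
    unfolding \<gamma>'_def using \<gamma> v[of m] t by (intro path_join_imp) (auto simp: pathfinish_def)
  moreover have "t' i < t' (Suc i) \<and> (\<exists>a b. \<forall>s\<in>{t' i..t' (Suc i)}. \<gamma>' s = a + s *\<^sub>R b)"
    if "i < Suc m" for i
  proof (cases "i < m")
    case True
    obtain a b where ab: "\<And>s. s \<in> {t i..t (Suc i)} \<Longrightarrow> \<gamma> s = a + s *\<^sub>R b" using aff[OF True] by blast
    have "\<gamma>' s = a + s *\<^sub>R (2 *\<^sub>R b)" if "s \<in> {t' i..t' (Suc i)}" for s
      using that True t1[of "Suc i"] ab[of "2 * s"] by (subst left) (auto simp: t'_def)
    then have "\<exists>a b. \<forall>s\<in>{t' i..t' (Suc i)}. \<gamma>' s = a + s *\<^sub>R b" by blast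
    moreover have "t' i < t' (Suc i)" using True inc[OF True] by (simp add: t'_def)
    ultimately show ?thesis by blast
  next
    case False
    then have i: "i = m" using that by simp
    have "\<forall>s\<in>{t' i..t' (Suc i)}. \<gamma>' s = (v m - d) + s *\<^sub>R (2 *\<^sub>R d)"
      using t right by (auto simp only: i t'_def) auto
    moreover have "t' i < t' (Suc i)" using t by (simp add: i t'_def)
    ultimately show ?thesis by blast
  qed
  moreover have "\<gamma>' (t' i) = v i" if "i \<le> Suc m" for i
  proof (cases "i \<le> m")
    case True
    then show ?thesis using v[OF True] t1[OF True] by (simp add: t'_def left)
  next
    case False
    then have "i = Suc m" using that by simp
    then show ?thesis by (simp add: t'_def right d_def scaleR_2)
  qed
  ultimately show ?case
    by (intro exI[of _ \<gamma>'] exI[of _ t']) (auto simp: t'_def t)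
qed

lemma polygon_cost_map:
  "polygon_cost g (map v [0..<Suc m]) = (\<Sum>i<m. segment_cost g (v i) (v (Suc i)))"
  unfolding polygon_cost_def by (auto intro!: sum.cong simp del: upt_Suc)

text \<open>Only the vertices of a path matter. Passing to lists of vertices removes the breakpoints and makes a
  restriction to countably many competitors possible.\<close>

lemma pseudometric_eq_INF_polygons:
  fixes \<phi> :: "real^'n \<Rightarrow> real"
  assumes g: "locally_bounded_borel (\<lambda>y. \<psi> (\<phi> y + l))"
  shows "pseudometric \<psi> l \<phi> {0} {x} = (INF vs. polygon_cost (\<lambda>y. \<psi> (\<phi> y + l)) (0 # vs @ [x]))"
proof -
  let ?g = "\<lambda>y. \<psi> (\<phi> y + l)"
  have "{length_integral \<gamma> ?g | \<gamma>. piecewise_affine_path \<gamma> \<and> pathstart \<gamma> \<in> {0} \<and> pathfinish \<gamma> \<in> {x}} =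
      range (\<lambda>vs. polygon_cost ?g (0 # vs @ [x]))" (is "?L = ?R")
  proof (intro equalityI subsetI)
    fix r assume "r \<in> ?L"
    then obtain \<gamma> where r: "r = length_integral \<gamma> ?g" and \<gamma>: "piecewise_affine_path \<gamma>"
      and ends: "\<gamma> 0 = 0" "\<gamma> 1 = x" by (auto simp: pathstart_def pathfinish_def)
    obtain m t where t: "t 0 = 0" "t m = (1::real)" "\<And>i. i < m \<Longrightarrow> t i < t (Suc i)"
      and aff: "\<And>i. i < m \<Longrightarrow> \<exists>a b. \<forall>s\<in>{t i..t (Suc i)}. \<gamma> s = a + s *\<^sub>R b"
      using \<gamma> unfolding piecewise_affine_path_def by blast
    have m: "0 < m" using t by (cases m) auto
    have "r = polygon_cost ?g (map (\<lambda>i. \<gamma> (t i)) [0..<Suc m])"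
      unfolding r polygon_cost_map using g t aff by (rule length_integral_eq_sum)
    also have "map (\<lambda>i. \<gamma> (t i)) [0..<Suc m] = 0 # map (\<lambda>i. \<gamma> (t i)) [1..<m] @ [x]"
      using m t ends by (simp add: upt_conv_Cons)
    finally show "r \<in> ?R" by blast
  next
    fix r assume "r \<in> ?R"
    then obtain vs where r: "r = polygon_cost ?g (0 # vs @ [x])" by blast
    let ?ws = "0 # vs @ [x]"
    define m where "m = Suc (length vs)"
    have "0 < m" by (simp add: m_def)
    from polygon_path_exists[OF this, of "\<lambda>i. ?ws ! i"]
    obtain \<gamma> t where \<gamma>: "path \<gamma>" and t: "t 0 = 0" "t m = (1::real)"
      and inc: "\<And>i. i < m \<Longrightarrow> t i < t (Suc i)"
      and aff: "\<And>i. i < m \<Longrightarrow> \<exists>a b. \<forall>s\<in>{t i..t (Suc i)}. \<gamma> s = a + s *\<^sub>R b"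
      and v: "\<And>i. i \<le> m \<Longrightarrow> \<gamma> (t i) = ?ws ! i" by blast
    have "piecewise_affine_path \<gamma>"
      unfolding piecewise_affine_path_def using \<gamma> t inc aff by blast
    moreover have "pathstart \<gamma> = 0" "pathfinish \<gamma> = x"
      using v[of 0] v[of m] t by (auto simp: pathstart_def pathfinish_def m_def nth_append)
    moreover have "length_integral \<gamma> ?g = r"
      using length_integral_eq_sum[OF g t inc aff] v
      by (simp add: r polygon_cost_def m_def)
    ultimately show "r \<in> ?L" by blast
  qed
  then show ?thesis unfolding pseudometric_def by simp
qed

lemma segment_cost_nonneg: "(\<And>y. 0 \<le> g y) \<Longrightarrow> 0 \<le> segment_cost g a b"
  unfolding segment_cost_def set_lebesgue_integral_def by (intro mult_nonneg_nonneg integral_nonneg_AE) auto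

lemma polygon_cost_nonneg: "(\<And>y. 0 \<le> g y) \<Longrightarrow> 0 \<le> polygon_cost g vs"
  unfolding polygon_cost_def by (intro sum_nonneg segment_cost_nonneg) auto

lemma segment_cost_mono:
  assumes "locally_bounded_borel g1" "locally_bounded_borel g2" "\<And>y. g1 y \<le> g2 y"
  shows "segment_cost g1 a b \<le> segment_cost g2 a b"
  unfolding segment_cost_def
  by (intro mult_left_mono set_integral_mono set_integrable_on_line assms norm_ge_zero)

lemma polygon_cost_mono:
  assumes "locally_bounded_borel g1" "locally_bounded_borel g2" "\<And>y. g1 y \<le> g2 y"
  shows "polygon_cost g1 vs \<le> polygon_cost g2 vs"
  unfolding polygon_cost_def by (intro sum_mono segment_cost_mono assms)

text \<open>The length of the segment inside the unit ball is at least the increment of \<open>min 1 (norm y)\<close> along it.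
  If the segment starts inside the ball, it stays inside up to a parameter at which the norm
  equals \<open>min 1 (norm b)\<close>, and by the triangle inequality this part is long enough.\<close>

lemma segment_cost_gain:
  fixes a b :: "real^'n"
  assumes g: "locally_bounded_borel g1" "locally_bounded_borel g2"
    and \<delta>: "0 \<le> \<delta>" and le: "\<And>y. g1 y + \<delta> * indicator (cball 0 1) y \<le> g2 y"
  shows "segment_cost g1 a b + \<delta> * (min 1 (norm b) - min 1 (norm a)) \<le> segment_cost g2 a b"
proof (cases "norm a \<ge> 1")
  case True
  have "g1 y \<le> g2 y" for y
    using le[of y] \<delta> by (smt (verit) indicator_pos_le mult_nonneg_nonneg)
  then have "segment_cost g1 a b \<le> segment_cost g2 a b"
    by (intro segment_cost_mono g)
  moreover have "\<delta> * (min 1 (norm b) - min 1 (norm a)) \<le> 0"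
    using \<delta> True by (intro mult_nonneg_nonpos) auto
  ultimately show ?thesis by simp
next
  case False
  let ?p = "\<lambda>u. a + u *\<^sub>R (b - a)"
  have "\<exists>u\<ge>0. u \<le> 1 \<and> norm (?p u) = min 1 (norm b)"
  proof (cases "norm b \<le> 1")
    case True
    then show ?thesis by (intro exI[of _ 1]) auto
  next
    case b: False
    show ?thesis
      by (rule IVT'[of "\<lambda>u. norm (?p u)"]) (use b False in \<open>auto intro!: continuous_intros\<close>)
  qed
  \<comment> \<open>Up to the parameter \<open>u\<close> the segment joins two points of the ball.\<close>
  then obtain u where u: "0 \<le> u" "u \<le> 1" and nu: "norm (?p u) = min 1 (norm b)" by blast
  have in_ball: "?p v \<in> cball 0 1" if "v \<in> {0..u}" for v
  proof (cases "u = 0")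
    case True
    then show ?thesis using that False by simp
  next
    case u0: False
    have "?p v = (1 - v / u) *\<^sub>R a + (v / u) *\<^sub>R ?p u"
      using u0 by (simp add: algebra_simps)
    also have "\<dots> \<in> cball 0 1"
      by (rule convexD[OF convex_cball]) (use False nu that u u0 in auto)
    finally show ?thesis .
  qed
  have i1: "set_integrable lborel {0..1} (\<lambda>v. g1 (?p v))"
    by (rule set_integrable_on_line) fact
  have i2: "set_integrable lborel {0..1} (\<lambda>v. g2 (?p v))"
    by (rule set_integrable_on_line) fact
  have i3: "set_integrable lborel {0..1} (\<lambda>v. \<delta> * indicator {0..u} v :: real)"
    unfolding set_integrable_def
    by (rule integrableI_bounded_set_indicator[where B = \<delta>]) (use \<delta> in \<open>auto simp: indicator_def\<close>)
  have "(LINT v:{0..1}|lborel. g1 (?p v)) + \<delta> * u =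
      (LINT v:{0..1}|lborel. g1 (?p v)) + (LINT v:{0..1}|lborel. \<delta> * indicator {0..u} v)"
  proof -
    have "(LINT v:{0..1}|lborel. \<delta> * indicator {0..u} v) = (LINT v|lborel. \<delta> * indicator {0..u} v)"
      unfolding set_lebesgue_integral_def using u
      by (intro Bochner_Integration.integral_cong refl) (auto simp: indicator_def)
    also have "\<dots> = \<delta> * u" using u by simp
    finally show ?thesis by (simp only:)
  qed
  also have "\<dots> = (LINT v:{0..1}|lborel. g1 (?p v) + \<delta> * indicator {0..u} v)"
    using i1 i3 by (rule set_integral_add(2)[symmetric])
  also have "\<dots> \<le> (LINT v:{0..1}|lborel. g2 (?p v))"
  proof (rule set_integral_mono[OF set_integral_add(1)[OF i1 i3] i2])
    fix v :: real
    show "g1 (?p v) + \<delta> * indicator {0..u} v \<le> g2 (?p v)"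
    proof (cases "v \<in> {0..u}")
      case True
      then show ?thesis using le[of "?p v"] in_ball[OF True] by (simp del: mem_cball_0)
    next
      case v: False
      have "0 \<le> \<delta> * indicator (cball 0 1) (?p v)" using \<delta> by simp
      then show ?thesis using le[of "?p v"] v by simp
    qed
  qed
  finally have I: "(LINT v:{0..1}|lborel. g1 (?p v)) + \<delta> * u \<le> (LINT v:{0..1}|lborel. g2 (?p v))" .
  have "min 1 (norm b) - min 1 (norm a) \<le> norm (u *\<^sub>R (b - a))"
    using nu norm_triangle_ineq[of a "u *\<^sub>R (b - a)"] False by simp
  also have "\<dots> = norm (b - a) * u" using u by simp
  finally have "\<delta> * (min 1 (norm b) - min 1 (norm a)) \<le> norm (b - a) * (\<delta> * u)"
    using \<delta> mult_left_mono by (metis mult.left_commute)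
  then have "segment_cost g1 a b + \<delta> * (min 1 (norm b) - min 1 (norm a)) \<le>
      norm (b - a) * ((LINT v:{0..1}|lborel. g1 (?p v)) + \<delta> * u)"
    by (simp add: segment_cost_def distrib_left)
  also have "\<dots> \<le> segment_cost g2 a b"
    unfolding segment_cost_def using I by (intro mult_left_mono) auto
  finally show ?thesis .
qed

text \<open>The increments of \<open>min 1 (norm y)\<close> telescope to \<open>1\<close> along a polygon from \<open>0\<close> to a point outside the
  open unit ball, however often the polygon enters and leaves the ball on its way.\<close>

lemma polygon_cost_gain:
  fixes x :: "real^'n"
  assumes g: "locally_bounded_borel g1" "locally_bounded_borel g2"
    and \<delta>: "0 \<le> \<delta>" and le: "\<And>y. g1 y + \<delta> * indicator (cball 0 1) y \<le> g2 y"
    and x: "1 \<le> norm x"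
  shows "polygon_cost g1 (0 # vs @ [x]) + \<delta> \<le> polygon_cost g2 (0 # vs @ [x])"
proof -
  let ?ws = "0 # vs @ [x]"
  let ?n = "length ?ws - 1"
  let ?r = "\<lambda>i. min 1 (norm (?ws ! i))"
  have "(\<Sum>i<?n. ?r (Suc i) - ?r i) = ?r ?n - ?r 0"
    by (rule sum_lessThan_telescope)
  also have "\<dots> = 1"
    using x by (simp add: nth_append)
  finally have "polygon_cost g1 ?ws + \<delta> =
      (\<Sum>i<?n. segment_cost g1 (?ws ! i) (?ws ! Suc i) + \<delta> * (?r (Suc i) - ?r i))"
    unfolding polygon_cost_def sum.distrib sum_distrib_left[symmetric] by simp
  also have "\<dots> \<le> polygon_cost g2 ?ws"
    unfolding polygon_cost_def by (intro sum_mono segment_cost_gain[OF g \<delta> le])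
  finally show ?thesis .
qed

lemma locally_bounded_borel_comp:
  fixes \<zeta> :: "real^'n \<Rightarrow> real"
  assumes \<psi>: "mono \<psi>" "\<And>x. 0 \<le> \<psi> x" and \<zeta>: "continuous_on UNIV \<zeta>"
  shows "locally_bounded_borel (\<lambda>y. \<psi> (\<zeta> y))"
  unfolding locally_bounded_borel_def
proof (intro conjI allI)
  have [measurable]: "\<psi> \<in> borel_measurable borel" "\<zeta> \<in> borel_measurable borel"
    using \<psi> \<zeta> by (auto intro: borel_measurable_mono borel_measurable_continuous_onI)
  show "(\<lambda>y. \<psi> (\<zeta> y)) \<in> borel_measurable borel" by measurable
  fix r
  have "bounded (\<zeta> ` cball 0 r)"
    by (intro compact_imp_bounded compact_continuous_image continuous_on_subset[OF \<zeta>]) auto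
  then obtain B where B: "\<And>y. y \<in> cball 0 r \<Longrightarrow> \<bar>\<zeta> y\<bar> \<le> B"
    unfolding bounded_iff by (metis imageI real_norm_def)
  have "\<bar>\<psi> (\<zeta> y)\<bar> \<le> \<psi> B" if "y \<in> cball 0 r" for y
    using monoD[OF \<psi>(1), of "\<zeta> y" B] B[OF that] \<psi>(2)[of "\<zeta> y"] by simp
  then show "\<exists>B. \<forall>y\<in>cball 0 r. \<bar>\<psi> (\<zeta> y)\<bar> \<le> B" by blast
qed

text \<open>For discontinuous \<open>\<psi>\<close> the cost is not continuous in the end points. The strict inequality between the
  two fields repairs this: on a compact set they differ by some \<open>\<eta> > 0\<close>, and moving a point by
  little changes \<open>\<zeta>1\<close> by less than \<open>\<eta>\<close>, so that monotonicity of \<open>\<psi>\<close> suffices. The error \<open>e\<close> only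
  pays for the change of the length of the segment.\<close>

lemma segment_cost_perturb:
  fixes a b :: "real^'n" and \<psi> :: "real \<Rightarrow> real"
  assumes \<psi>: "mono \<psi>" "\<And>x. 0 \<le> \<psi> x"
    and \<zeta>: "continuous_on UNIV \<zeta>1" "continuous_on UNIV \<zeta>2" and less: "\<And>y. \<zeta>1 y < \<zeta>2 y"
    and e: "0 < e"
  shows "\<exists>d>0. \<forall>a' b'. dist a' a < d \<and> dist b' b < d \<longrightarrow>
    segment_cost (\<lambda>y. \<psi> (\<zeta>1 y)) a' b' \<le> segment_cost (\<lambda>y. \<psi> (\<zeta>2 y)) a b + e"
proof -
  let ?S = "cball 0 (norm a + norm b + 1) :: (real^'n) set"
  note lb = locally_bounded_borel_comp[OF \<psi>]
  have c: "continuous_on ?S \<zeta>1" "continuous_on ?S (\<lambda>y. \<zeta>2 y - \<zeta>1 y)"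
    using \<zeta> by (auto intro!: continuous_intros intro: continuous_on_subset)
  have "?S \<noteq> {}"
    using norm_ge_zero[of a] norm_ge_zero[of b] by (simp add: not_less)
  from continuous_attains_inf[OF compact_cball this c(2)]
  obtain y0 where "\<forall>y\<in>?S. \<zeta>2 y0 - \<zeta>1 y0 \<le> \<zeta>2 y - \<zeta>1 y" by blast
  then obtain \<eta> where \<eta>: "0 < \<eta>" "\<And>y. y \<in> ?S \<Longrightarrow> \<eta> \<le> \<zeta>2 y - \<zeta>1 y"
    using less[of y0] by (intro that[of "\<zeta>2 y0 - \<zeta>1 y0"]) auto
  obtain d1 where d1: "0 < d1" "\<And>y z. y \<in> ?S \<Longrightarrow> z \<in> ?S \<Longrightarrow> dist z y < d1 \<Longrightarrow> dist (\<zeta>1 z) (\<zeta>1 y) < \<eta>"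
    using compact_uniformly_continuous[OF c(1) compact_cball] \<eta>(1)
    unfolding uniformly_continuous_on_def by blast
  obtain B0 where B0: "\<And>y. y \<in> ?S \<Longrightarrow> \<bar>\<psi> (\<zeta>2 y)\<bar> \<le> B0"
    using lb[OF \<zeta>(2)] unfolding locally_bounded_borel_def by blast
  define B where "B = max B0 0 + 1"
  have B: "0 < B" "\<And>y. y \<in> ?S \<Longrightarrow> \<psi> (\<zeta>2 y) \<le> B"
    using B0 by (auto simp: B_def) (smt (verit) B0)
  define d where "d = min (d1 / 2) (min 1 (e / (2 * B)))"
  have "0 < d" "d \<le> d1 / 2" "d \<le> 1" "d \<le> e / (2 * B)"
    using d1 e B by (simp_all add: d_def)
  then have d: "0 < d" "d < d1" "d \<le> 1" "2 * d * B \<le> e"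
    using d1 B(1) by (simp_all add: pos_le_divide_eq mult.commute mult.left_commute)
  show ?thesis
  proof (intro exI[of _ d] conjI allI impI d(1), elim conjE)
    fix a' b' assume ab: "dist a' a < d" "dist b' b < d"
    let ?p = "\<lambda>u. a + u *\<^sub>R (b - a)" and ?p' = "\<lambda>u. a' + u *\<^sub>R (b' - a')"
    let ?I1 = "LINT u:{0..1}|lborel. \<psi> (\<zeta>1 (?p' u))" and ?I2 = "LINT u:{0..1}|lborel. \<psi> (\<zeta>2 (?p u))"
    have seg: "p + u *\<^sub>R (r - p) \<in> cball 0 R" if "norm p \<le> R" "norm r \<le> R" "u \<in> {0..1}"
      for p r :: "real^'n" and u R :: real
    proof -
      have "p + u *\<^sub>R (r - p) = (1 - u) *\<^sub>R p + u *\<^sub>R r" by (simp add: algebra_simps)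
      also have "\<dots> \<in> cball 0 R"
        by (rule convexD[OF convex_cball]) (use that in auto)
      finally show ?thesis .
    qed
    have na': "norm a' \<le> norm a + 1"
      using ab(1) d(3) norm_triangle_ineq2[of a' a] by (simp add: dist_norm)
    have nb': "norm b' \<le> norm b + 1"
      using ab(2) d(3) norm_triangle_ineq2[of b' b] by (simp add: dist_norm)
    have inS: "?p u \<in> ?S" "?p' u \<in> ?S" if "u \<in> {0..1}" for u
      using that na' nb' norm_ge_zero[of a] norm_ge_zero[of b] by (intro seg; linarith)+
    have close: "dist (?p' u) (?p u) < d1" if u: "u \<in> {0..1}" for u
    proof -
      have "?p' u - ?p u = (a' - a) + u *\<^sub>R ((b' - b) - (a' - a))"
        by (simp add: algebra_simps)
      also have "\<dots> \<in> cball 0 d" using ab u by (intro seg) (auto simp: dist_norm)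
      finally have "norm (?p' u - ?p u) \<le> d" by (simp only: mem_cball_0)
      then show ?thesis using d(2) unfolding dist_norm by simp
    qed
    have le: "\<psi> (\<zeta>1 (?p' u)) \<le> \<psi> (\<zeta>2 (?p u))" if u: "u \<in> {0..1}" for u
    proof (rule monoD[OF \<psi>(1)])
      show "\<zeta>1 (?p' u) \<le> \<zeta>2 (?p u)"
        using d1(2)[OF inS(1)[OF u] inS(2)[OF u] close[OF u]] \<eta>(2)[OF inS(1)[OF u]]
        by (simp add: dist_real_def abs_less_iff)
    qed
    have I12: "?I1 \<le> ?I2"
      unfolding set_lebesgue_integral_def
      using set_integrable_on_line[OF lb[OF \<zeta>(1)], of 0 1] set_integrable_on_line[OF lb[OF \<zeta>(2)], of 0 1] le
      by (intro integral_mono) (auto simp: set_integrable_def indicator_def)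
    have I2: "0 \<le> ?I2"
      unfolding set_lebesgue_integral_def using \<psi>(2) by (intro integral_nonneg_AE) auto
    have "set_integrable lborel {0..1::real} (\<lambda>_. B)"
      unfolding set_integrable_def
      by (rule integrableI_bounded_set_indicator[where B = B]) (use B(1) in auto)
    then have "?I2 \<le> (LINT u:{0..1::real}|lborel. B)"
      using set_integrable_on_line[OF lb[OF \<zeta>(2)], of 0 1] B(2)[OF inS(1)]
      by (intro set_integral_mono)
    then have I2B: "?I2 \<le> B" by (simp add: set_lebesgue_integral_def)
    have nn: "norm (b' - a') \<le> norm (b - a) + 2 * d"
    proof -
      have "b' - a' = (b - a) + ((b' - b) - (a' - a))" by simp
      then have "norm (b' - a') \<le> norm (b - a) + norm ((b' - b) - (a' - a))"
        by (metis norm_triangle_ineq)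
      also have "norm ((b' - b) - (a' - a)) \<le> norm (b' - b) + norm (a' - a)"
        by (rule norm_triangle_ineq4)
      finally show ?thesis using ab by (simp add: dist_norm)
    qed
    have "norm (b' - a') * ?I1 \<le> norm (b' - a') * ?I2"
      using I12 by (intro mult_left_mono) auto
    also have "\<dots> \<le> (norm (b - a) + 2 * d) * ?I2"
      using nn I2 by (intro mult_right_mono) auto
    also have "\<dots> \<le> norm (b - a) * ?I2 + 2 * d * B"
      using I2B d(1) by (simp add: distrib_right)
    finally show "segment_cost (\<lambda>y. \<psi> (\<zeta>1 y)) a' b' \<le> segment_cost (\<lambda>y. \<psi> (\<zeta>2 y)) a b + e"
      unfolding segment_cost_def using d(4) by linarith
  qed
qed

lemma polygon_cost_perturb:
  fixes x :: "real^'n" and \<psi> :: "real \<Rightarrow> real"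
  assumes \<psi>: "mono \<psi>" "\<And>x. 0 \<le> \<psi> x"
    and \<zeta>: "continuous_on UNIV \<zeta>1" "continuous_on UNIV \<zeta>2" and less: "\<And>y. \<zeta>1 y < \<zeta>2 y"
    and D: "\<And>v d. 0 < d \<Longrightarrow> \<exists>w\<in>D. dist w v < d" and e: "0 < e"
  shows "\<exists>ws\<in>lists D. polygon_cost (\<lambda>y. \<psi> (\<zeta>1 y)) (0 # ws @ [x]) \<le>
    polygon_cost (\<lambda>y. \<psi> (\<zeta>2 y)) (0 # vs @ [x]) + e"
proof -
  let ?vs = "0 # vs @ [x]"
  define n where "n = length ?vs - 1"
  have n: "0 < n" by (simp add: n_def)
  let ?e = "e / real n"
  have "\<forall>i. \<exists>d>0. \<forall>a' b'. dist a' (?vs ! i) < d \<and> dist b' (?vs ! Suc i) < d \<longrightarrow>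
    segment_cost (\<lambda>y. \<psi> (\<zeta>1 y)) a' b' \<le> segment_cost (\<lambda>y. \<psi> (\<zeta>2 y)) (?vs ! i) (?vs ! Suc i) + ?e"
    using n e by (intro allI segment_cost_perturb \<psi> \<zeta> less) auto
  then obtain d where d: "\<And>i. 0 < d i"
    and seg: "\<And>i a' b'. dist a' (?vs ! i) < d i \<Longrightarrow> dist b' (?vs ! Suc i) < d i \<Longrightarrow>
      segment_cost (\<lambda>y. \<psi> (\<zeta>1 y)) a' b' \<le> segment_cost (\<lambda>y. \<psi> (\<zeta>2 y)) (?vs ! i) (?vs ! Suc i) + ?e"
    by metis
  define d0 where "d0 = Min (d ` {..<n})"
  have d0: "0 < d0" using n d by (simp add: d0_def lessThan_empty_iff)
  have d0_le: "d0 \<le> d i" if "i < n" for i using that by (simp add: d0_def)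
  obtain w where w: "\<And>v. w v \<in> D" "\<And>v. dist (w v) v < d0" using D[OF d0] by metis
  let ?ws = "0 # map w vs @ [x]"
  have close: "dist (?ws ! i) (?vs ! i) < d0" if "i \<le> n" for i
    using that w(2) d0 by (cases i) (auto simp: n_def nth_append)
  have "polygon_cost (\<lambda>y. \<psi> (\<zeta>1 y)) ?ws \<le>
      (\<Sum>i<n. segment_cost (\<lambda>y. \<psi> (\<zeta>2 y)) (?vs ! i) (?vs ! Suc i) + ?e)"
    unfolding polygon_cost_def
  proof (rule order.trans[OF eq_refl sum_mono])
    show "(\<Sum>i<length ?ws - 1. segment_cost (\<lambda>y. \<psi> (\<zeta>1 y)) (?ws ! i) (?ws ! Suc i)) =
        (\<Sum>i<n. segment_cost (\<lambda>y. \<psi> (\<zeta>1 y)) (?ws ! i) (?ws ! Suc i))"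
      by (simp add: n_def)
    fix i assume "i \<in> {..<n}"
    then have i: "i < n" by simp
    show "segment_cost (\<lambda>y. \<psi> (\<zeta>1 y)) (?ws ! i) (?ws ! Suc i) \<le>
        segment_cost (\<lambda>y. \<psi> (\<zeta>2 y)) (?vs ! i) (?vs ! Suc i) + ?e"
      using close[of i] close[of "Suc i"] d0_le[OF i] i by (intro seg) auto
  qed
  also have "\<dots> = polygon_cost (\<lambda>y. \<psi> (\<zeta>2 y)) ?vs + e"
    using n unfolding polygon_cost_def n_def[symmetric] by (simp add: sum.distrib)
  finally show ?thesis using w(1) by (intro bexI[of _ "map w vs"]) auto
qed

section \<open>Polygons with vertices in a dense set\<close>

definition polygon_inf :: "(real^'n) set \<Rightarrow> (real^'n \<Rightarrow> real) \<Rightarrow> real^'n \<Rightarrow> real" where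
  "polygon_inf D g x = (INF vs\<in>lists D. polygon_cost g (0 # vs @ [x]))"

lemma bdd_below_polygon_costs:
  "(\<And>y. 0 \<le> g y) \<Longrightarrow> bdd_below ((\<lambda>vs. polygon_cost g (0 # vs @ [x])) ` A)"
  by (intro bdd_belowI2[of _ 0] polygon_cost_nonneg)

lemma polygon_inf_le:
  "(\<And>y. 0 \<le> g y) \<Longrightarrow> vs \<in> lists D \<Longrightarrow> polygon_inf D g x \<le> polygon_cost g (0 # vs @ [x])"
  unfolding polygon_inf_def by (intro cINF_lower bdd_below_polygon_costs)

lemma polygon_inf_greatest:
  "(\<And>vs. vs \<in> lists D \<Longrightarrow> r \<le> polygon_cost g (0 # vs @ [x])) \<Longrightarrow> r \<le> polygon_inf D g x"
  unfolding polygon_inf_def by (intro cINF_greatest) (auto intro: lists.Nil)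

lemma polygon_inf_nonneg: "(\<And>y. 0 \<le> g y) \<Longrightarrow> 0 \<le> polygon_inf D g x"
  by (intro polygon_inf_greatest polygon_cost_nonneg)

lemma polygon_inf_antimono:
  "(\<And>y. 0 \<le> g y) \<Longrightarrow> D \<subseteq> E \<Longrightarrow> polygon_inf E g x \<le> polygon_inf D g x"
  using lists_mono by (intro polygon_inf_greatest polygon_inf_le) auto

lemma polygon_inf_gain:
  fixes x :: "real^'n"
  assumes g: "locally_bounded_borel g1" "locally_bounded_borel g2" and nn: "\<And>y. 0 \<le> g1 y"
    and \<delta>: "0 \<le> \<delta>" and le: "\<And>y. g1 y + \<delta> * indicator (cball 0 1) y \<le> g2 y"
    and x: "1 \<le> norm x"
  shows "polygon_inf D g1 x + \<delta> \<le> polygon_inf D g2 x"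
proof (rule polygon_inf_greatest)
  fix vs assume "vs \<in> lists D"
  then have "polygon_inf D g1 x \<le> polygon_cost g1 (0 # vs @ [x])"
    by (intro polygon_inf_le nn)
  then show "polygon_inf D g1 x + \<delta> \<le> polygon_cost g2 (0 # vs @ [x])"
    using polygon_cost_gain[OF g \<delta> le x, of vs] by linarith
qed

lemma polygon_inf_mono:
  fixes x :: "real^'n"
  assumes g: "locally_bounded_borel g1" "locally_bounded_borel g2" and nn: "\<And>y. 0 \<le> g1 y"
    and le: "\<And>y. g1 y \<le> g2 y"
  shows "polygon_inf D g1 x \<le> polygon_inf D g2 x"
  by (rule polygon_inf_greatest)
    (rule order.trans[OF polygon_inf_le polygon_cost_mono], use assms in auto)

text \<open>One half of the sandwich between the infimum over all polygons and the infimum over those with vertices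
  in \<open>D\<close>; the other half, for equal fields, is \<open>polygon_inf_antimono\<close>.\<close>

lemma polygon_inf_dense_le:
  fixes x :: "real^'n" and \<psi> :: "real \<Rightarrow> real"
  assumes \<psi>: "mono \<psi>" "\<And>x. 0 \<le> \<psi> x"
    and \<zeta>: "continuous_on UNIV \<zeta>1" "continuous_on UNIV \<zeta>2" and less: "\<And>y. \<zeta>1 y < \<zeta>2 y"
    and D: "\<And>v d. 0 < d \<Longrightarrow> \<exists>w\<in>D. dist w v < d"
  shows "polygon_inf D (\<lambda>y. \<psi> (\<zeta>1 y)) x \<le> polygon_inf UNIV (\<lambda>y. \<psi> (\<zeta>2 y)) x"
proof (rule polygon_inf_greatest, rule field_le_epsilon)
  fix vs and e :: real assume "0 < e"
  from polygon_cost_perturb[OF \<psi> \<zeta> less D this, of x vs]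
  obtain ws where "ws \<in> lists D" and *: "polygon_cost (\<lambda>y. \<psi> (\<zeta>1 y)) (0 # ws @ [x]) \<le>
    polygon_cost (\<lambda>y. \<psi> (\<zeta>2 y)) (0 # vs @ [x]) + e" by blast
  then have "polygon_inf D (\<lambda>y. \<psi> (\<zeta>1 y)) x \<le> polygon_cost (\<lambda>y. \<psi> (\<zeta>1 y)) (0 # ws @ [x])"
    by (intro polygon_inf_le \<psi>)
  with * show "polygon_inf D (\<lambda>y. \<psi> (\<zeta>1 y)) x \<le> polygon_cost (\<lambda>y. \<psi> (\<zeta>2 y)) (0 # vs @ [x]) + e"
    by linarith
qed

section \<open>Measurability as a functional of the field\<close>

abbreviation function_space :: "(real^'n \<Rightarrow> real) measure" where
  "function_space \<equiv> \<Pi>\<^sub>M y\<in>UNIV. borel"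

text \<open>A fixed sequence of simple functions converging to the identity. It plays the role of rounding to
  finer and finer grids, and makes point evaluation jointly measurable.\<close>

definition simple_approx :: "nat \<Rightarrow> real^'n \<Rightarrow> real^'n" where
  "simple_approx = (SOME F. (\<forall>n. simple_function borel (F n)) \<and> (\<forall>y. (\<lambda>n. F n y) \<longlonglongrightarrow> y))"

lemma simple_approx:
  "simple_function borel (simple_approx n)" "(\<lambda>n. simple_approx n y) \<longlonglongrightarrow> y"
proof -
  have "\<exists>F :: nat \<Rightarrow> real^'n \<Rightarrow> real^'n. (\<forall>n. simple_function borel (F n)) \<and> (\<forall>y. (\<lambda>n. F n y) \<longlonglongrightarrow> y)"
    using borel_measurable_implies_sequence_metric[of "\<lambda>y::real^'n. y" borel 0] by auto
  from someI_ex[OF this]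
  show "simple_function borel (simple_approx n)" "(\<lambda>n. simple_approx n y) \<longlonglongrightarrow> y"
    unfolding simple_approx_def by blast+
qed

text \<open>Evaluation \<open>(\<phi>, y) \<mapsto> \<phi> y\<close> is not measurable for the product sigma-algebra. This functional is, because
  \<open>simple_approx n\<close> has finite range, and it agrees with evaluation on continuous functions.\<close>

definition reconstruct :: "(real^'n \<Rightarrow> real) \<Rightarrow> real^'n \<Rightarrow> real" where
  "reconstruct \<phi> y = lim (\<lambda>n. \<phi> (simple_approx n y))"

lemma reconstruct_continuous:
  assumes "continuous_on UNIV \<phi>"
  shows "reconstruct \<phi> = \<phi>"
proof
  fix y
  have "(\<lambda>n. \<phi> (simple_approx n y)) \<longlonglongrightarrow> \<phi> y"
    using continuous_on_tendsto_compose[OF assms simple_approx(2)] by simp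
  then show "reconstruct \<phi> y = \<phi> y" unfolding reconstruct_def by (rule limI)
qed

lemma measurable_reconstruct [measurable]:
  "(\<lambda>z. reconstruct (fst z) (snd z)) \<in>
    borel_measurable (function_space \<Otimes>\<^sub>M (borel :: (real^'n) measure))"
  unfolding reconstruct_def
proof (rule borel_measurable_lim_metric)
  fix n
  let ?s = "simple_approx n :: real^'n \<Rightarrow> real^'n"
  have fin: "finite (range ?s)" using simple_functionD(1)[OF simple_approx(1)[of n]] by simp
  have [measurable]: "?s \<in> measurable borel (count_space UNIV)"
    using measurable_simple_function[OF simple_approx(1)[of n]] .
  have "(\<lambda>z. fst z (?s (snd z))) =
      (\<lambda>z. \<Sum>v\<in>range ?s. indicator {v} (?s (snd z)) * fst z v :: real)"
  proof
    fix z :: "(real^'n \<Rightarrow> real) \<times> (real^'n)"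
    have "(\<Sum>v\<in>range ?s. indicator {v} (?s (snd z)) * fst z v) =
        (\<Sum>v\<in>{?s (snd z)}. indicator {v} (?s (snd z)) * fst z v)"
      using fin by (intro sum.mono_neutral_right) auto
    then show "fst z (?s (snd z)) = (\<Sum>v\<in>range ?s. indicator {v} (?s (snd z)) * fst z v)"
      by simp
  qed
  also have "\<dots> \<in> borel_measurable (function_space \<Otimes>\<^sub>M (borel :: (real^'n) measure))"
  proof (intro borel_measurable_sum borel_measurable_times)
    fix v
    have "(\<lambda>z. indicator {v} (?s (snd z)) :: real) \<in> borel_measurable (function_space \<Otimes>\<^sub>M borel)"
      by (rule measurable_compose[OF _ borel_measurable_indicator[of "{v}" "count_space UNIV"]]) simp_all
    then show "(\<lambda>z. indicator {v} (?s (snd z)) :: real) \<in>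
      borel_measurable (function_space \<Otimes>\<^sub>M borel)" .
    show "(\<lambda>z. fst z v) \<in>
      borel_measurable (function_space \<Otimes>\<^sub>M (borel :: (real^'n) measure))"
      by measurable
  qed
  finally show "(\<lambda>z. fst z (?s (snd z))) \<in> borel_measurable (function_space \<Otimes>\<^sub>M borel)" .
qed

lemma measurable_polygon_cost_reconstruct:
  fixes vs :: "(real^'n) list"
  assumes [measurable]: "\<psi> \<in> borel_measurable borel"
  shows "(\<lambda>\<phi>. polygon_cost (\<lambda>y. \<psi> (reconstruct \<phi> y + l)) vs) \<in> borel_measurable function_space"
  unfolding polygon_cost_def segment_cost_def set_lebesgue_integral_def
proof (intro borel_measurable_sum borel_measurable_times borel_measurable_const
    lborel.borel_measurable_lebesgue_integral)
  fix a b :: "real^'n"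
  have "(\<lambda>z. (fst z, a + snd z *\<^sub>R b)) \<in> measurable (function_space \<Otimes>\<^sub>M lborel)
      (function_space \<Otimes>\<^sub>M borel)" by measurable
  from measurable_compose[OF this measurable_reconstruct]
  have [measurable]: "(\<lambda>z. reconstruct (fst z) (a + snd z *\<^sub>R b)) \<in>
      borel_measurable (function_space \<Otimes>\<^sub>M lborel)" by simp
  have "(\<lambda>z. indicator {0..1} (snd z) *\<^sub>R \<psi> (reconstruct (fst z) (a + snd z *\<^sub>R b) + l)) \<in>
      borel_measurable (function_space \<Otimes>\<^sub>M lborel)" by measurable
  then show "(\<lambda>(\<phi>, u). indicator {0..1} u *\<^sub>R \<psi> (reconstruct \<phi> (a + u *\<^sub>R b) + l)) \<in>
      borel_measurable (function_space \<Otimes>\<^sub>M lborel)"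
    by (simp add: split_beta)
qed

lemma measurable_polygon_inf_reconstruct:
  fixes x :: "real^'n"
  assumes "countable D" "\<psi> \<in> borel_measurable borel"
  shows "(\<lambda>\<phi>. polygon_inf D (\<lambda>y. \<psi> (reconstruct \<phi> y + l)) x) \<in> borel_measurable function_space"
  unfolding polygon_inf_def
  by (intro borel_measurable_cINF_real countable_lists measurable_polygon_cost_reconstruct assms)

section \<open>Fields with one resampled Gaussian coordinate\<close>

text \<open>The Cauchy-Schwarz inequality on the unit interval, from expanding the square of \<open>k - m\<close>
  for the mean \<open>m\<close>.\<close>

lemma integral_square_le:
  fixes k :: "real \<Rightarrow> real"
  assumes i1: "set_integrable lborel {0..1} k" and i2: "set_integrable lborel {0..1} (\<lambda>u. (k u)\<^sup>2)"
  shows "(LINT u:{0..1}|lborel. k u)\<^sup>2 \<le> (LINT u:{0..1}|lborel. (k u)\<^sup>2)"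
proof -
  define m where "m = (LINT u:{0..1}|lborel. k u)"
  have ic: "set_integrable lborel {0..1::real} (\<lambda>_. m\<^sup>2)"
    unfolding set_integrable_def
    by (rule integrableI_bounded_set_indicator[where B = "m\<^sup>2"]) auto
  have ik: "set_integrable lborel {0..1} (\<lambda>u. 2 * m * k u)" using i1 by simp
  have "0 \<le> (LINT u:{0..1}|lborel. (k u - m)\<^sup>2)"
    unfolding set_lebesgue_integral_def by (intro integral_nonneg_AE) auto
  also have "\<dots> = (LINT u:{0..1}|lborel. ((k u)\<^sup>2 - 2 * m * k u) + m\<^sup>2)"
    by (simp add: power2_diff algebra_simps)
  also have "\<dots> = (LINT u:{0..1}|lborel. (k u)\<^sup>2) - 2 * m * m + m\<^sup>2"
    using set_integral_diff(2)[OF i2 ik] set_integral_add(2)[OF set_integral_diff(1)[OF i2 ik] ic]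
    by (simp add: m_def set_lebesgue_integral_def[of _ _ "\<lambda>_. _"])
  finally show ?thesis by (simp add: m_def power2_eq_square)
qed

lemma std_normal_interval_pos:
  assumes "a < b"
  shows "0 < measure std_normal_distribution {a..b}"
proof -
  interpret real_distribution std_normal_distribution by (rule real_dist_normal_dist)
  have "emeasure std_normal_distribution {a..b} \<noteq> 0"
  proof
    assume "emeasure std_normal_distribution {a..b} = 0"
    then have "AE x in lborel. x \<in> {a..b} \<longrightarrow> ennreal (std_normal_density x) = 0"
      by (subst (asm) emeasure_density)
        (auto simp: nn_integral_0_iff_AE elim!: eventually_mono)
    moreover have "0 < std_normal_density x" for x by (rule normal_density_pos) simp
    ultimately have "AE x in lborel. x \<notin> {a..b}"
      by (auto simp: not_less elim!: eventually_mono) (metis less_le_not_le)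
    then have "emeasure lborel {a..b} = 0"
      by (subst (asm) AE_iff_measurable[where N = "{a..b}"]) auto
    then show False using assms by simp
  qed
  then show ?thesis by (simp add: emeasure_eq_measure zero_less_measure_iff)
qed

text \<open>A field whose law does not change when its \<open>\<xi>\<close>-component along \<open>h\<close> is resampled; it is in the form of
  this invariance that Gaussianity enters the lower bound on the variance. The set \<open>D\<close> is the countable dense set that serves as a supply of vertices.\<close>

locale perturbed_field =
  fixes M :: "'w measure" and f :: "real^'n \<Rightarrow> 'w \<Rightarrow> real" and \<xi> :: "'w \<Rightarrow> real"
    and h :: "real^'n \<Rightarrow> real" and \<psi> :: "real \<Rightarrow> real" and l :: real and D :: "(real^'n) set"
    and v :: real
  assumes M: "prob_space M"
    and f_meas [measurable]: "\<And>x. f x \<in> borel_measurable M"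
    and xi_meas [measurable]: "\<xi> \<in> borel_measurable M"
    and f_cont: "AE \<omega> in M. continuous_on UNIV (\<lambda>x. f x \<omega>)"
    and f_square: "\<And>x. integrable M (\<lambda>\<omega>. (f x \<omega>)\<^sup>2)" "\<And>x. (LINT \<omega>|M. (f x \<omega>)\<^sup>2) = v"
    and h_cont: "continuous_on UNIV h" and h_pos: "\<And>x. 0 < h x"
    and law: "distr M (\<Pi>\<^sub>M x\<in>UNIV. borel) (\<lambda>\<omega> x. f x \<omega>) =
      distr (M \<Otimes>\<^sub>M std_normal_distribution) (\<Pi>\<^sub>M x\<in>UNIV. borel)
        (\<lambda>z x. f x (fst z) - \<xi> (fst z) * h x + snd z * h x)"
    and psi: "admissible_psi \<psi>"
    and D: "countable D" "\<And>v d. 0 < d \<Longrightarrow> \<exists>w\<in>D. dist w v < d"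
begin

sublocale prob_space M by (rule M)
sublocale N: real_distribution std_normal_distribution by (rule real_dist_normal_dist)
sublocale P: pair_prob_space M std_normal_distribution ..

abbreviation product_space :: "('w \<times> real) measure" where
  "product_space \<equiv> M \<Otimes>\<^sub>M std_normal_distribution"

definition residual :: "'w \<Rightarrow> real^'n \<Rightarrow> real" where
  "residual \<omega> x = f x \<omega> - \<xi> \<omega> * h x"

text \<open>The field with \<open>\<xi>\<close> replaced by the second coordinate of a point of the product space.\<close>

definition resampled :: "'w \<times> real \<Rightarrow> real^'n \<Rightarrow> real" where
  "resampled z x = f x (fst z) - \<xi> (fst z) * h x + snd z * h x"

text \<open>The measurable substitute for the pseudometric between \<open>0\<close> and \<open>x\<close>, defined for arbitrary, possibly
  discontinuous, functions.\<close>

definition passage :: "real^'n \<Rightarrow> (real^'n \<Rightarrow> real) \<Rightarrow> real" where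
  "passage x \<phi> = polygon_inf D (\<lambda>y. \<psi> (reconstruct \<phi> y + l)) x"

lemma psi_mono: "mono \<psi>" and psi_nonneg: "\<And>y. 0 \<le> \<psi> y"
  and psi_meas [measurable]: "\<psi> \<in> borel_measurable borel" and psi_pos: "\<And>y. 0 < \<psi> y \<longleftrightarrow> 0 < y"
  using psi by (auto simp: admissible_psi_def)

lemma passage_measurable [measurable]: "passage x \<in> borel_measurable function_space"
  unfolding passage_def using D(1) by (intro measurable_polygon_inf_reconstruct) measurable

lemma field_measurable [measurable]: "(\<lambda>\<omega> x. f x \<omega>) \<in> measurable M function_space"
  by (intro measurable_PiM_single') auto

lemma resampled_measurable [measurable]: "resampled \<in> measurable product_space function_space"
  unfolding resampled_def by (intro measurable_PiM_single') auto

lemma law_resampled: "distr M function_space (\<lambda>\<omega> x. f x \<omega>) = distr product_space function_space resampled"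
  using law by (simp add: resampled_def[abs_def])

lemma AE_field_of_resampled:
  assumes [measurable]: "Measurable.pred function_space Q" and "AE z in product_space. Q (resampled z)"
  shows "AE \<omega> in M. Q (\<lambda>x. f x \<omega>)"
proof -
  have Q: "{\<phi> \<in> space function_space. Q \<phi>} \<in> sets function_space" by measurable
  have "AE \<phi> in distr M function_space (\<lambda>\<omega> x. f x \<omega>). Q \<phi>"
    unfolding law_resampled AE_distr_iff[OF resampled_measurable Q] by fact
  then show ?thesis unfolding AE_distr_iff[OF field_measurable Q] .
qed

lemma prob_field_eq_resampled:
  assumes [measurable]: "Measurable.pred function_space Q"
  shows "emeasure M {\<omega> \<in> space M. Q (\<lambda>x. f x \<omega>)} = emeasure product_space {z \<in> space product_space. Q (resampled z)}"
proof -
  have Q: "{\<phi> \<in> space function_space. Q \<phi>} \<in> sets function_space" by measurable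
  have "emeasure M {\<omega> \<in> space M. Q (\<lambda>x. f x \<omega>)} =
      emeasure (distr M function_space (\<lambda>\<omega> x. f x \<omega>)) {\<phi> \<in> space function_space. Q \<phi>}"
    by (subst emeasure_distr[OF field_measurable Q]) (auto simp: space_PiM intro!: arg_cong[where f = "emeasure M"])
  also have "\<dots> = emeasure product_space {z \<in> space product_space. Q (resampled z)}"
    unfolding law_resampled
    by (subst emeasure_distr[OF resampled_measurable Q])
      (auto simp: space_PiM intro!: arg_cong[where f = "emeasure product_space"])
  finally show ?thesis .
qed

lemma residual_continuous:
  assumes "continuous_on UNIV (\<lambda>x. f x \<omega>)"
  shows "continuous_on UNIV (residual \<omega>)"
  unfolding residual_def by (intro continuous_intros assms h_cont)

lemma resampled_eq: "resampled (\<omega>, s) = (\<lambda>x. residual \<omega> x + s * h x)"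
  by (simp add: resampled_def residual_def fun_eq_iff)

lemma passage_eq:
  "continuous_on UNIV \<phi> \<Longrightarrow> passage x \<phi> = polygon_inf D (\<lambda>y. \<psi> (\<phi> y + l)) x"
  by (simp add: passage_def reconstruct_continuous)

lemma cost_locally_bounded:
  "continuous_on UNIV \<phi> \<Longrightarrow> locally_bounded_borel (\<lambda>y. \<psi> (\<phi> y + l))"
  by (intro locally_bounded_borel_comp[OF psi_mono psi_nonneg]) (auto intro!: continuous_intros)

lemma passage_mono:
  assumes "continuous_on UNIV \<phi>1" "continuous_on UNIV \<phi>2" "\<And>y. \<phi>1 y \<le> \<phi>2 y"
  shows "passage x \<phi>1 \<le> passage x \<phi>2"
  unfolding passage_eq[OF assms(1)] passage_eq[OF assms(2)]
  using assms(3)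
  by (intro polygon_inf_mono cost_locally_bounded assms(1,2) psi_nonneg monoD[OF psi_mono]) auto

lemma pseudometric_eq_polygon_inf:
  assumes "continuous_on UNIV \<phi>"
  shows "pseudometric \<psi> l \<phi> {0} {x} = polygon_inf UNIV (\<lambda>y. \<psi> (\<phi> y + l)) x"
  using pseudometric_eq_INF_polygons[where \<psi> = \<psi>, OF cost_locally_bounded[OF assms]]
  by (simp add: polygon_inf_def)

text \<open>Left continuity at \<open>\<phi>\<close> of the passage functional in direction \<open>h\<close>. Testing it along the sequence
  \<open>1 / Suc n\<close> suffices by monotonicity, and keeps the condition measurable in \<open>\<phi>\<close>.\<close>

definition left_continuous_at :: "real^'n \<Rightarrow> (real^'n \<Rightarrow> real) \<Rightarrow> bool" where
  "left_continuous_at x \<phi> \<longleftrightarrow> (\<forall>k::nat. \<exists>n::nat.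
     passage x \<phi> \<le> passage x (\<lambda>y. \<phi> y + - (1 / Suc n) * h y) + 1 / Suc k)"

text \<open>For every \<open>n\<close> the pseudometric lies between the values of the passage functional at
  \<open>\<phi> - h / (n + 1)\<close> and at \<open>\<phi>\<close>, and left continuity closes the gap.\<close>

lemma pseudometric_eq_passage:
  assumes \<phi>: "continuous_on UNIV \<phi>" and lc: "left_continuous_at x \<phi>"
  shows "pseudometric \<psi> l \<phi> {0} {x} = passage x \<phi>"
proof (rule antisym)
  show "pseudometric \<psi> l \<phi> {0} {x} \<le> passage x \<phi>"
    unfolding pseudometric_eq_polygon_inf[OF \<phi>] passage_eq[OF \<phi>]
    by (intro polygon_inf_antimono psi_nonneg) auto
  show "passage x \<phi> \<le> pseudometric \<psi> l \<phi> {0} {x}"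
  proof (rule field_le_epsilon)
    fix e :: real assume "0 < e"
    then obtain k where k: "1 / Suc k < e" using nat_approx_posE by blast
    obtain n where n: "passage x \<phi> \<le> passage x (\<lambda>y. \<phi> y + - (1 / Suc n) * h y) + 1 / Suc k"
      using lc unfolding left_continuous_at_def by blast
    have c: "continuous_on UNIV (\<lambda>y. \<phi> y + - (1 / Suc n) * h y)"
      by (intro continuous_intros \<phi> h_cont)
    have "passage x (\<lambda>y. \<phi> y + - (1 / Suc n) * h y) \<le> pseudometric \<psi> l \<phi> {0} {x}"
      unfolding pseudometric_eq_polygon_inf[OF \<phi>] passage_eq[OF c]
      using c \<phi> h_pos
      by (intro polygon_inf_dense_le psi_mono psi_nonneg D(2)) (auto intro!: continuous_intros)
    with n k show "passage x \<phi> \<le> pseudometric \<psi> l \<phi> {0} {x} + e" by linarith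
  qed
qed

lemma AE_not_in_countable:
  assumes "countable C"
  shows "AE s in std_normal_distribution. s \<notin> C"
proof -
  have "AE s in lborel. s \<notin> C"
    by (intro AE_not_in countable_imp_null_set_lborel assms)
  then show ?thesis by (subst AE_density) (auto elim!: eventually_mono)
qed

text \<open>A monotone function has countably many discontinuities, and a normal variable avoids them
  almost surely.\<close>

lemma AE_left_continuous_line:
  assumes "continuous_on UNIV \<phi>"
  shows "AE s in std_normal_distribution. left_continuous_at x (\<lambda>y. \<phi> y + s * h y)"
proof -
  define V where "V s = passage x (\<lambda>y. \<phi> y + s * h y)" for s
  have c: "continuous_on UNIV (\<lambda>y. \<phi> y + s * h y)" for s
    by (intro continuous_intros assms h_cont)
  have "mono V"
    unfolding V_def using h_pos by (intro monoI passage_mono c) (auto intro!: mult_right_mono less_imp_le)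
  then have "AE s in std_normal_distribution. s \<notin> {s. \<not> isCont V s}"
    by (intro AE_not_in_countable mono_ctble_discont)
  then show ?thesis
  proof eventually_elim
    case (elim s)
    then have cont: "isCont V s" by simp
    show ?case unfolding left_continuous_at_def
    proof
      fix k :: nat
      have "(\<lambda>n. s + - (1 / Suc n)) \<longlonglongrightarrow> s + - 0"
        by (intro tendsto_intros LIMSEQ_Suc[OF lim_1_over_n])
      then have "(\<lambda>n. V (s + - (1 / Suc n))) \<longlonglongrightarrow> V s"
        using isCont_tendsto_compose[OF cont] by simp
      then have "\<forall>\<^sub>F n in sequentially. V s - 1 / Suc k < V (s + - (1 / Suc n))"
        by (rule order_tendstoD) simp
      then obtain n where n: "V s - 1 / Suc k < V (s + - (1 / Suc n))"
        unfolding eventually_sequentially by blast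
      have "(\<lambda>y. \<phi> y + (s + - (1 / Suc n)) * h y) = (\<lambda>y. (\<phi> y + s * h y) + - (1 / Suc n) * h y)"
        by (intro ext) (simp only: distrib_right add.assoc)
      then show "\<exists>n. passage x (\<lambda>y. \<phi> y + s * h y) \<le>
          passage x (\<lambda>y. (\<phi> y + s * h y) + - (1 / Suc n) * h y) + 1 / Suc k"
        using n unfolding V_def by (intro exI[of _ n]) simp
    qed
  qed
qed

lemma left_continuous_at_measurable [measurable]:
  "Measurable.pred function_space (left_continuous_at x)"
proof -
  have *: "(\<lambda>\<phi>. passage x (\<lambda>y. \<phi> y + c * h y)) \<in> borel_measurable function_space" for c
  proof (rule measurable_compose[OF _ passage_measurable])
    show "(\<lambda>\<phi> y. \<phi> y + c * h y) \<in> measurable function_space function_space"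
      by (intro measurable_PiM_single') (auto simp: space_PiM)
  qed
  have "Measurable.pred function_space (\<lambda>\<phi>. passage x \<phi> \<le>
      passage x (\<lambda>y. \<phi> y + - (1 / Suc n) * h y) + 1 / Suc k)" for n k
    unfolding pred_def
    by (intro borel_measurable_le borel_measurable_add * passage_measurable borel_measurable_const)
  then show ?thesis unfolding left_continuous_at_def
    by (intro pred_intros_countable)
qed

text \<open>Left continuity holds almost surely on the product space by Fubini, and it is an event of the field
  alone, so it carries over to \<open>f\<close> through the equality of laws.\<close>

lemma AE_pseudometric_eq_passage:
  "AE \<omega> in M. pseudometric \<psi> l (\<lambda>y. f y \<omega>) {0} {x} = passage x (\<lambda>y. f y \<omega>)"
proof -
  have "AE z in product_space. left_continuous_at x (resampled z)"
  proof (rule P.AE_pair_measure)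
    show "{z \<in> space product_space. left_continuous_at x (resampled z)} \<in> sets product_space"
      by measurable
    show "AE \<omega> in M. AE s in std_normal_distribution. left_continuous_at x (resampled (\<omega>, s))"
      using f_cont unfolding resampled_eq
      by eventually_elim (intro AE_left_continuous_line residual_continuous)
  qed
  then have "AE \<omega> in M. left_continuous_at x (\<lambda>y. f y \<omega>)"
    by (intro AE_field_of_resampled) measurable
  with f_cont show ?thesis
    by eventually_elim (rule pseudometric_eq_passage)
qed

end

section \<open>Second moments and the lower bound on the variance\<close>

text \<open>In a complete space a function that agrees almost everywhere with a measurable one is measurable; this
  is what makes the pseudometric a random variable.\<close>

lemma borel_measurable_completion_cong:
  fixes X Y :: "'a \<Rightarrow> real"
  assumes X: "X \<in> borel_measurable M" and ae: "AE \<omega> in M. Y \<omega> = X \<omega>"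
  shows "Y \<in> borel_measurable (completion M)"
proof (rule measurableI)
  fix A :: "real set" assume A: "A \<in> sets borel"
  show "Y -` A \<inter> space (completion M) \<in> sets (completion M)"
  proof (rule completion.in_sets_AE)
    show "X -` A \<inter> space (completion M) \<in> sets (completion M)"
      using measurable_sets[OF X A] by simp
    have "AE \<omega> in M. \<omega> \<in> X -` A \<inter> space M \<longleftrightarrow> \<omega> \<in> Y -` A \<inter> space M"
      using ae by eventually_elim auto
    then show "AE \<omega> in completion M.
        \<omega> \<in> X -` A \<inter> space (completion M) \<longleftrightarrow> \<omega> \<in> Y -` A \<inter> space (completion M)"
      unfolding space_completion by (rule AE_completion)
  qed simp
qed simp

lemma Var_cong_AE:
  assumes X [measurable]: "X \<in> borel_measurable M" and ae: "AE \<omega> in M. Y \<omega> = X \<omega>"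
  shows "Var M Y = (LINT \<omega>|M. (X \<omega> - (LINT \<omega>|M. X \<omega>))\<^sup>2)"
proof -
  have Y: "Y \<in> borel_measurable (completion M)"
    by (rule borel_measurable_completion_cong) fact+
  have X': "X \<in> borel_measurable (completion M)"
    by (intro measurable_completion X)
  have ae': "AE \<omega> in completion M. Y \<omega> = X \<omega>" by (rule AE_completion) fact
  have "(LINT \<omega>|completion M. Y \<omega>) = (LINT \<omega>|M. X \<omega>)"
    using integral_cong_AE[OF Y X' ae'] by (simp add: integral_completion X)
  moreover have "(LINT \<omega>|completion M. (Y \<omega> - c)\<^sup>2) = (LINT \<omega>|M. (X \<omega> - c)\<^sup>2)" for c
  proof -
    have "(LINT \<omega>|completion M. (Y \<omega> - c)\<^sup>2) = (LINT \<omega>|completion M. (X \<omega> - c)\<^sup>2)"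
      using Y X' ae' by (intro integral_cong_AE) auto
    then show ?thesis by (simp add: integral_completion)
  qed
  ultimately show ?thesis unfolding Var_def by simp
qed

context perturbed_field
begin

text \<open>The straight segment from \<open>0\<close> to \<open>x\<close> is a competitor in the infimum.\<close>

lemma passage_square_le:
  assumes \<phi>: "continuous_on UNIV \<phi>" and bound: "\<And>y. \<psi> (y + l) \<le> a + C * \<bar>y\<bar>"
  shows "ennreal ((passage x \<phi>)\<^sup>2) \<le>
    (\<integral>\<^sup>+u. ennreal ((norm x)\<^sup>2 * indicator {0..1} u * (2 * a\<^sup>2 + 2 * C\<^sup>2 * (\<phi> (u *\<^sub>R x))\<^sup>2)) \<partial>lborel)"
proof -
  let ?g = "\<lambda>y. \<psi> (\<phi> y + l)"
  have lb2: "locally_bounded_borel (\<lambda>y. (?g y)\<^sup>2)"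
  proof (rule locally_bounded_borel_comp[where \<psi> = "\<lambda>y. (\<psi> y)\<^sup>2"])
    show "mono (\<lambda>y. (\<psi> y)\<^sup>2)"
      using psi_mono psi_nonneg by (auto intro!: monoI power_mono dest: monoD)
    show "continuous_on UNIV (\<lambda>y. \<phi> y + l)" by (intro continuous_intros \<phi>)
  qed simp
  have i1: "set_integrable lborel {0..1} (\<lambda>u. ?g (u *\<^sub>R x))"
    using set_integrable_on_line[OF cost_locally_bounded[OF \<phi>], of 0 1 0 x] by simp
  have i2: "set_integrable lborel {0..1} (\<lambda>u. (?g (u *\<^sub>R x))\<^sup>2)"
    using set_integrable_on_line[OF lb2, of 0 1 0 x] by simp
  have "passage x \<phi> \<le> polygon_cost ?g (0 # [] @ [x])"
    unfolding passage_eq[OF \<phi>] by (intro polygon_inf_le psi_nonneg) simp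
  also have "\<dots> = norm x * (LINT u:{0..1}|lborel. ?g (u *\<^sub>R x))"
    by (simp add: polygon_cost_def segment_cost_def)
  finally have "(passage x \<phi>)\<^sup>2 \<le> (norm x * (LINT u:{0..1}|lborel. ?g (u *\<^sub>R x)))\<^sup>2"
    using polygon_inf_nonneg[of ?g] psi_nonneg by (intro power_mono) (auto simp: passage_eq[OF \<phi>])
  also have "\<dots> \<le> (norm x)\<^sup>2 * (LINT u:{0..1}|lborel. (?g (u *\<^sub>R x))\<^sup>2)"
    unfolding power_mult_distrib by (intro mult_left_mono integral_square_le i1 i2) simp
  also have "\<dots> = (LINT u|lborel. (norm x)\<^sup>2 * (indicator {0..1} u * (?g (u *\<^sub>R x))\<^sup>2))"
    by (simp add: set_lebesgue_integral_def)
  finally have "ennreal ((passage x \<phi>)\<^sup>2) \<le>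
      ennreal (LINT u|lborel. (norm x)\<^sup>2 * (indicator {0..1} u * (?g (u *\<^sub>R x))\<^sup>2))"
    by (rule ennreal_leI)
  also have "\<dots> = (\<integral>\<^sup>+u. ennreal ((norm x)\<^sup>2 * (indicator {0..1} u * (?g (u *\<^sub>R x))\<^sup>2)) \<partial>lborel)"
    using i2 by (intro nn_integral_eq_integral[symmetric]) (auto simp: set_integrable_def)
  also have "\<dots> \<le> (\<integral>\<^sup>+u. ennreal ((norm x)\<^sup>2 * indicator {0..1} u *
      (2 * a\<^sup>2 + 2 * C\<^sup>2 * (\<phi> (u *\<^sub>R x))\<^sup>2)) \<partial>lborel)"
  proof (intro nn_integral_mono ennreal_leI)
    fix u :: real
    have "?g (u *\<^sub>R x) \<le> a + C * \<bar>\<phi> (u *\<^sub>R x)\<bar>" by (rule bound)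
    then have "(?g (u *\<^sub>R x))\<^sup>2 \<le> (a + C * \<bar>\<phi> (u *\<^sub>R x)\<bar>)\<^sup>2"
      using psi_nonneg by (intro power_mono) auto
    also have "\<dots> \<le> 2 * a\<^sup>2 + 2 * (C * \<bar>\<phi> (u *\<^sub>R x)\<bar>)\<^sup>2"
      using sum_squares_bound[of a "C * \<bar>\<phi> (u *\<^sub>R x)\<bar>"] by (simp add: power2_sum)
    finally have "(?g (u *\<^sub>R x))\<^sup>2 \<le> 2 * a\<^sup>2 + 2 * C\<^sup>2 * (\<phi> (u *\<^sub>R x))\<^sup>2"
      by (simp add: power_mult_distrib)
    then have "((norm x)\<^sup>2 * indicator {0..1} u) * (?g (u *\<^sub>R x))\<^sup>2 \<le>
        ((norm x)\<^sup>2 * indicator {0..1} u) * (2 * a\<^sup>2 + 2 * C\<^sup>2 * (\<phi> (u *\<^sub>R x))\<^sup>2)"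
      by (intro mult_left_mono) auto
    then show "(norm x)\<^sup>2 * (indicator {0..1} u * (?g (u *\<^sub>R x))\<^sup>2) \<le>
        (norm x)\<^sup>2 * indicator {0..1} u * (2 * a\<^sup>2 + 2 * C\<^sup>2 * (\<phi> (u *\<^sub>R x))\<^sup>2)"
      by (simp only: mult.assoc)
  qed
  finally show ?thesis .
qed

lemma psi_linear_bound: "\<exists>a C. \<forall>y. \<psi> (y + l) \<le> a + C * \<bar>y\<bar>"
proof -
  obtain C where C: "0 < C" "\<And>y. 1 \<le> y \<Longrightarrow> \<psi> y \<le> C * y"
    using psi unfolding admissible_psi_def by blast
  have "\<psi> (y + l) \<le> (\<psi> 1 + C * \<bar>l\<bar>) + C * \<bar>y\<bar>" for y
  proof (cases "y + l \<le> 1")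
    case True
    then have "\<psi> (y + l) \<le> \<psi> 1" using psi_mono by (auto dest: monoD)
    moreover have "0 \<le> C * \<bar>l\<bar>" "0 \<le> C * \<bar>y\<bar>" using C by auto
    ultimately show ?thesis by linarith
  next
    case False
    then have "\<psi> (y + l) \<le> C * (y + l)" by (intro C(2)) simp
    also have "\<dots> \<le> C * (\<bar>l\<bar> + \<bar>y\<bar>)" using C(1) by (intro mult_left_mono) auto
    finally show ?thesis using psi_nonneg[of 1] by (simp add: distrib_left)
  qed
  then show ?thesis by blast
qed

text \<open>By Tonelli the expected square along the straight segment is an integral of second moments of the
  field, which do not depend on the point.\<close>

lemma integrable_passage_square: "integrable M (\<lambda>\<omega>. (passage x (\<lambda>y. f y \<omega>))\<^sup>2)"
proof (rule integrableI_nonneg)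
  have [measurable]: "(\<lambda>\<omega>. passage x (\<lambda>y. f y \<omega>)) \<in> borel_measurable M"
    by (rule measurable_compose[OF field_measurable passage_measurable])
  show "(\<lambda>\<omega>. (passage x (\<lambda>y. f y \<omega>))\<^sup>2) \<in> borel_measurable M" by measurable
  show "AE \<omega> in M. 0 \<le> (passage x (\<lambda>y. f y \<omega>))\<^sup>2" by simp
  obtain a C where bound: "\<And>y. \<psi> (y + l) \<le> a + C * \<bar>y\<bar>" using psi_linear_bound by blast
  interpret PL: pair_sigma_finite M lborel ..
  define R where "R \<omega> u = reconstruct (\<lambda>y. f y \<omega>) (u *\<^sub>R x)" for \<omega> and u :: real
  define G where "G \<omega> u = (norm x)\<^sup>2 * indicator {0..1} u * (2 * a\<^sup>2 + 2 * C\<^sup>2 * (R \<omega> u)\<^sup>2)" for \<omega> u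
  have [measurable]: "(\<lambda>z. R (fst z) (snd z)) \<in> borel_measurable (M \<Otimes>\<^sub>M lborel)"
  proof -
    have "(\<lambda>z. ((\<lambda>y. f y (fst z)), snd z *\<^sub>R x)) \<in>
        measurable (M \<Otimes>\<^sub>M lborel) (function_space \<Otimes>\<^sub>M borel)"
      by (intro measurable_Pair measurable_compose[OF measurable_fst field_measurable]) measurable
    from measurable_compose[OF this measurable_reconstruct] show ?thesis
      by (simp add: R_def)
  qed
  have "AE \<omega> in M. ennreal ((passage x (\<lambda>y. f y \<omega>))\<^sup>2) \<le> (\<integral>\<^sup>+u. ennreal (G \<omega> u) \<partial>lborel)"
    using f_cont
  proof eventually_elim
    case (elim \<omega>)
    then show ?case
      using passage_square_le[OF elim bound, of x]
      by (simp add: G_def R_def reconstruct_continuous)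
  qed
  then have "(\<integral>\<^sup>+\<omega>. ennreal ((passage x (\<lambda>y. f y \<omega>))\<^sup>2) \<partial>M) \<le>
      (\<integral>\<^sup>+\<omega>. (\<integral>\<^sup>+u. ennreal (G \<omega> u) \<partial>lborel) \<partial>M)"
    by (rule nn_integral_mono_AE)
  also have "\<dots> = (\<integral>\<^sup>+u. (\<integral>\<^sup>+\<omega>. ennreal (G \<omega> u) \<partial>M) \<partial>lborel)"
    by (rule PL.Fubini'[symmetric]) (simp add: split_beta G_def)
  also have "\<dots> = (\<integral>\<^sup>+u. ennreal ((norm x)\<^sup>2 * (2 * a\<^sup>2 + 2 * C\<^sup>2 * v)) * indicator {0..1::real} u \<partial>lborel)"
  proof (intro nn_integral_cong)
    fix u :: real
    let ?c = "(norm x)\<^sup>2 * indicator {0..1} u :: real"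
    have "(\<integral>\<^sup>+\<omega>. ennreal (G \<omega> u) \<partial>M) =
        (\<integral>\<^sup>+\<omega>. ennreal (?c * (2 * a\<^sup>2 + 2 * C\<^sup>2 * (f (u *\<^sub>R x) \<omega>)\<^sup>2)) \<partial>M)"
    proof (rule nn_integral_cong_AE)
      show "AE \<omega> in M. ennreal (G \<omega> u) =
          ennreal (?c * (2 * a\<^sup>2 + 2 * C\<^sup>2 * (f (u *\<^sub>R x) \<omega>)\<^sup>2))"
        using f_cont by eventually_elim (simp add: G_def R_def reconstruct_continuous)
    qed
    also have "\<dots> = ennreal (LINT \<omega>|M. ?c * (2 * a\<^sup>2 + 2 * C\<^sup>2 * (f (u *\<^sub>R x) \<omega>)\<^sup>2))"
      using f_square by (intro nn_integral_eq_integral) auto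
    also have "(LINT \<omega>|M. ?c * (2 * a\<^sup>2 + 2 * C\<^sup>2 * (f (u *\<^sub>R x) \<omega>)\<^sup>2)) =
        ?c * (2 * a\<^sup>2 + 2 * C\<^sup>2 * v)"
      using f_square by (simp add: prob_space)
    finally show "(\<integral>\<^sup>+\<omega>. ennreal (G \<omega> u) \<partial>M) =
        ennreal ((norm x)\<^sup>2 * (2 * a\<^sup>2 + 2 * C\<^sup>2 * v)) * indicator {0..1} u"
      by (simp add: indicator_def)
  qed
  also have "\<dots> < \<infinity>"
    by (simp add: nn_integral_cmult_indicator ennreal_mult_less_top)
  finally show "(\<integral>\<^sup>+\<omega>. ennreal ((passage x (\<lambda>y. f y \<omega>))\<^sup>2) \<partial>M) < \<infinity>" .
qed

text \<open>A continuous function is bounded on a compact set, so the events that the residual is bounded by \<open>K\<close>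
  exhaust the space as \<open>K\<close> grows. Only the points of \<open>D\<close> are tested, to have an event; since the
  points of \<open>D\<close> used lie in an open ball of radius 2, density covers the closed unit ball.\<close>

lemma residual_bounded_event:
  "\<exists>(K::real) E. 0 \<le> K \<and> E \<in> sets M \<and> 1 / 2 \<le> measure M E \<and>
    (AE \<omega> in M. \<omega> \<in> E \<longrightarrow> (\<forall>y\<in>cball 0 1. \<bar>residual \<omega> y\<bar> \<le> K))"
proof -
  define E where "E K = {\<omega> \<in> space M. \<forall>d\<in>D \<inter> ball 0 2. \<bar>residual \<omega> d\<bar> \<le> real K}" for K
  have [measurable]: "(\<lambda>\<omega>. residual \<omega> d) \<in> borel_measurable M" for d
    unfolding residual_def by measurable
  have E [measurable]: "E K \<in> sets M" for K
    unfolding E_def using D(1)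
    by (intro sets.sets_Collect_countable_All' countable_Int1) measurable
  have inc: "incseq E"
    unfolding E_def by (intro incseq_SucI) (auto intro: order.trans)
  have "AE \<omega> in M. \<omega> \<in> (\<Union>K. E K)"
    using f_cont AE_space
  proof eventually_elim
    case (elim \<omega>)
    have "bounded (residual \<omega> ` cball 0 2)"
      by (intro compact_imp_bounded compact_continuous_image
          continuous_on_subset[OF residual_continuous[OF elim(1)]]) auto
    then obtain B where B: "\<And>y. y \<in> cball 0 2 \<Longrightarrow> \<bar>residual \<omega> y\<bar> \<le> B"
      unfolding bounded_iff by (metis imageI real_norm_def)
    obtain K :: nat where "B \<le> real K" using real_arch_simple by blast
    then have "\<bar>residual \<omega> d\<bar> \<le> real K" if "d \<in> D \<inter> ball 0 2" for d
      using B[of d] that by simp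
    then have "\<omega> \<in> E K" using elim(2) unfolding E_def by blast
    then show ?case by blast
  qed
  then have "measure M (\<Union>K. E K) = 1"
    by (intro prob_eq_1[THEN iffD2]) auto
  then have "(\<lambda>K. measure M (E K)) \<longlonglongrightarrow> 1"
    using finite_Lim_measure_incseq[OF _ inc] E by (metis image_subsetI)
  then have "\<forall>\<^sub>F K in sequentially. 1 / 2 < measure M (E K)"
    by (rule order_tendstoD) simp
  then obtain K where K: "1 / 2 < measure M (E K)"
    unfolding eventually_sequentially by blast
  have "AE \<omega> in M. \<omega> \<in> E K \<longrightarrow> (\<forall>y\<in>cball 0 1. \<bar>residual \<omega> y\<bar> \<le> real K)"
    using f_cont
  proof eventually_elim
    case (elim \<omega>)
    show ?case
    proof (intro impI ballI, rule ccontr)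
      fix y :: "real^'n" assume E: "\<omega> \<in> E K" and y: "y \<in> cball 0 1" and neg: "\<not> \<bar>residual \<omega> y\<bar> \<le> real K"
      have "continuous_on UNIV (\<lambda>y. \<bar>residual \<omega> y\<bar>)"
        by (intro continuous_intros residual_continuous elim)
      then have "open ({y. real K < \<bar>residual \<omega> y\<bar>})"
        by (intro open_Collect_less continuous_on_const)
      then have "open ({y. real K < \<bar>residual \<omega> y\<bar>} \<inter> ball 0 2)" by auto
      moreover have "y \<in> {y. real K < \<bar>residual \<omega> y\<bar>} \<inter> ball 0 2" using y neg by auto
      ultimately obtain e where e: "0 < e" "ball y e \<subseteq> {y. real K < \<bar>residual \<omega> y\<bar>} \<inter> ball 0 2"
        using open_contains_ball by blast
      obtain d where "d \<in> D" "dist d y < e" using D(2)[OF e(1)] by blast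
      then have "d \<in> D \<inter> ball 0 2" "real K < \<bar>residual \<omega> d\<bar>"
        using e(2) by (auto simp: dist_commute subset_iff)
      then show False using E unfolding E_def by (auto simp: not_le[symmetric])
    qed
  qed
  then show ?thesis
    using K E by (intro exI[of _ "real K"] exI[of _ "E K"]) auto
qed

text \<open>Here \<open>s1\<close> is low enough to make the integrand vanish on the closed unit ball, and \<open>s2\<close> high enough to
  make it at least \<open>\<psi> 1\<close> there.\<close>

lemma passage_gap:
  assumes \<phi>: "continuous_on UNIV \<phi>" and K: "\<And>y. y \<in> cball 0 1 \<Longrightarrow> \<bar>\<phi> y\<bar> \<le> K" "0 \<le> K"
    and \<eta>: "0 < \<eta>" "\<And>y. y \<in> cball 0 1 \<Longrightarrow> \<eta> \<le> h y"
    and s: "s1 = - (K + \<bar>l\<bar>) / \<eta>" "s2 = (K + \<bar>l\<bar> + 1) / \<eta>"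
    and x: "1 \<le> norm x"
  shows "passage x (\<lambda>y. \<phi> y + s1 * h y) + \<psi> 1 \<le> passage x (\<lambda>y. \<phi> y + s2 * h y)"
proof -
  have c: "continuous_on UNIV (\<lambda>y. \<phi> y + s * h y)" for s
    by (intro continuous_intros \<phi> h_cont)
  have s0: "s1 \<le> 0" "0 \<le> s2" using K(2) \<eta>(1) by (auto simp: s divide_nonpos_pos)
  show ?thesis unfolding passage_eq[OF c]
  proof (rule polygon_inf_gain[OF cost_locally_bounded[OF c] cost_locally_bounded[OF c] psi_nonneg psi_nonneg _ x])
    fix y :: "real^'n"
    show "\<psi> (\<phi> y + s1 * h y + l) + \<psi> 1 * indicator (cball 0 1) y \<le> \<psi> (\<phi> y + s2 * h y + l)"
    proof (cases "y \<in> cball 0 1")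
      case True
      have "s1 * h y \<le> s1 * \<eta>" using s0 \<eta>(2)[OF True] by (intro mult_left_mono_neg)
      also have "\<dots> = - (K + \<bar>l\<bar>)" using \<eta>(1) by (simp add: s)
      finally have "\<phi> y + s1 * h y + l \<le> 0" using K(1)[OF True] by linarith
      then have z: "\<psi> (\<phi> y + s1 * h y + l) = 0"
        using psi_pos[of "\<phi> y + s1 * h y + l"] psi_nonneg[of "\<phi> y + s1 * h y + l"] by linarith
      have "K + \<bar>l\<bar> + 1 = s2 * \<eta>" using \<eta>(1) by (simp add: s)
      also have "\<dots> \<le> s2 * h y" using s0 \<eta>(2)[OF True] by (intro mult_left_mono)
      finally have "1 \<le> \<phi> y + s2 * h y + l" using K(1)[OF True] by linarith
      then show ?thesis using z True psi_mono by (auto dest: monoD)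
    next
      case False
      have "s1 * h y \<le> s2 * h y" using s0 h_pos[of y] by (intro mult_right_mono) auto
      then have "\<psi> (\<phi> y + s1 * h y + l) \<le> \<psi> (\<phi> y + s2 * h y + l)"
        by (intro monoD[OF psi_mono]) simp
      then show ?thesis using False by simp
    qed
  qed
qed

text \<open>Given the residual, either the low value of \<open>T(0,x)\<close> lies \<open>\<delta> / 2\<close> below the mean or the high
  value lies \<open>\<delta> / 2\<close> above it, because they are at least \<open>\<delta>\<close> apart. By monotonicity this persists on
  an interval of values of \<open>s\<close> adjacent to \<open>s1\<close> or \<open>s2\<close>, whose probability does not depend on
  \<open>x\<close> or on the residual.\<close>

theorem variance_lower_bound:
  "\<exists>c>0. \<forall>x. 1 \<le> norm x \<longrightarrow> c \<le> Var M (\<lambda>\<omega>. pseudometric \<psi> l (\<lambda>y. f y \<omega>) {0} {x})"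
proof -
  obtain K E where K: "0 \<le> K" and E [measurable]: "E \<in> sets M" and pE: "1 / 2 \<le> measure M E"
    and EK: "AE \<omega> in M. \<omega> \<in> E \<longrightarrow> (\<forall>y\<in>cball 0 1. \<bar>residual \<omega> y\<bar> \<le> K)"
    using residual_bounded_event by blast
  have "continuous_on (cball 0 1) h" by (rule continuous_on_subset[OF h_cont]) auto
  from continuous_attains_inf[OF compact_cball _ this]
  obtain y0 where "\<forall>y\<in>cball 0 1. h y0 \<le> h y" by auto
  then obtain \<eta> where \<eta>: "0 < \<eta>" "\<And>y. y \<in> cball 0 1 \<Longrightarrow> \<eta> \<le> h y"
    using h_pos[of y0] by blast
  define s1 where "s1 = - (K + \<bar>l\<bar>) / \<eta>"
  define s2 where "s2 = (K + \<bar>l\<bar> + 1) / \<eta>"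
  define p where "p = min (measure std_normal_distribution {s1 - 1..s1}) (measure std_normal_distribution {s2..s2 + 1})"
  have p: "0 < p" unfolding p_def by (simp add: std_normal_interval_pos)
  define \<delta> where "\<delta> = \<psi> 1"
  have \<delta>: "0 < \<delta>" by (simp add: \<delta>_def psi_pos)
  have main: "(\<delta> / 2)\<^sup>2 * (p / 2) \<le> Var M (\<lambda>\<omega>. pseudometric \<psi> l (\<lambda>y. f y \<omega>) {0} {x})"
    if x: "1 \<le> norm x" for x
  proof -
    define X where "X \<omega> = passage x (\<lambda>y. f y \<omega>)" for \<omega>
    have X [measurable]: "X \<in> borel_measurable M"
      unfolding X_def by (rule measurable_compose[OF field_measurable passage_measurable])
    have X2: "integrable M (\<lambda>\<omega>. (X \<omega>)\<^sup>2)"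
      unfolding X_def by (rule integrable_passage_square)
    have X1: "integrable M X" by (rule square_integrable_imp_integrable[OF X X2])
    define m where "m = (LINT \<omega>|M. X \<omega>)"
    define Q where "Q \<phi> \<longleftrightarrow> \<delta> / 2 \<le> \<bar>passage x \<phi> - m\<bar>" for \<phi>
    have Q [measurable]: "Measurable.pred function_space Q"
      unfolding Q_def by measurable
    have slice: "AE \<omega> in M. ennreal p * indicator E \<omega> \<le>
        emeasure std_normal_distribution (Pair \<omega> -` {z \<in> space product_space. Q (resampled z)})"
      using f_cont EK AE_space
    proof eventually_elim
      case (elim \<omega>)
      let ?S = "Pair \<omega> -` {z \<in> space product_space. Q (resampled z)}"
      have S: "?S \<in> sets std_normal_distribution"
        by (rule sets_Pair1) measurable
      show ?case
      proof (cases "\<omega> \<in> E")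
        case True
        note c = residual_continuous[OF elim(1)]
        have cs: "continuous_on UNIV (\<lambda>y. residual \<omega> y + s * h y)" for s
          by (intro continuous_intros c h_cont)
        define V where "V s = passage x (\<lambda>y. residual \<omega> y + s * h y)" for s
        have mono: "V s \<le> V t" if "s \<le> t" for s t
          unfolding V_def using h_pos that
          by (intro passage_mono cs) (auto intro!: mult_right_mono less_imp_le)
        have gap: "V s1 + \<delta> \<le> V s2"
          unfolding V_def \<delta>_def
          by (rule passage_gap[OF c _ K \<eta> s1_def s2_def x]) (use elim(2) True in auto)
        have inS: "s \<in> ?S \<longleftrightarrow> \<delta> / 2 \<le> \<bar>V s - m\<bar>" for s
          using elim(3) by (simp add: space_pair_measure Q_def V_def resampled_eq)
        have "{s1 - 1..s1} \<subseteq> ?S \<or> {s2..s2 + 1} \<subseteq> ?S"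
        proof (cases "V s1 \<le> m - \<delta> / 2")
          case True
          have "s \<in> ?S" if "s \<in> {s1 - 1..s1}" for s
          proof -
            have "V s \<le> V s1" using that by (intro mono) simp
            with True show ?thesis unfolding inS by linarith
          qed
          then show ?thesis by blast
        next
          case False
          have "s \<in> ?S" if "s \<in> {s2..s2 + 1}" for s
          proof -
            have "V s2 \<le> V s" using that by (intro mono) simp
            with False gap show ?thesis unfolding inS by linarith
          qed
          then show ?thesis by blast
        qed
        then have "p \<le> measure std_normal_distribution ?S"
          unfolding p_def
        proof
          assume "{s1 - 1..s1} \<subseteq> ?S"
          from N.finite_measure_mono[OF this S] show "min (measure std_normal_distribution {s1 - 1..s1})
              (measure std_normal_distribution {s2..s2 + 1}) \<le> measure std_normal_distribution ?S"
            by (rule min.coboundedI1)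
        next
          assume "{s2..s2 + 1} \<subseteq> ?S"
          from N.finite_measure_mono[OF this S] show "min (measure std_normal_distribution {s1 - 1..s1})
              (measure std_normal_distribution {s2..s2 + 1}) \<le> measure std_normal_distribution ?S"
            by (rule min.coboundedI2)
        qed
        then show ?thesis using True by (simp add: N.emeasure_eq_measure ennreal_leI)
      qed simp
    qed
    have "ennreal (p / 2) \<le> ennreal p * emeasure M E"
      using p pE by (simp add: emeasure_eq_measure flip: ennreal_mult)
    also have "\<dots> = (\<integral>\<^sup>+\<omega>. ennreal p * indicator E \<omega> \<partial>M)"
      by (simp add: nn_integral_cmult_indicator)
    also have "\<dots> \<le> (\<integral>\<^sup>+\<omega>. emeasure std_normal_distribution
        (Pair \<omega> -` {z \<in> space product_space. Q (resampled z)}) \<partial>M)"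
      by (rule nn_integral_mono_AE[OF slice])
    also have "\<dots> = emeasure product_space {z \<in> space product_space. Q (resampled z)}"
      by (rule N.emeasure_pair_measure_alt[symmetric]) measurable
    also have "\<dots> = emeasure M {\<omega> \<in> space M. Q (\<lambda>y. f y \<omega>)}"
      by (rule prob_field_eq_resampled[symmetric]) measurable
    finally have pQ: "p / 2 \<le> measure M {\<omega> \<in> space M. Q (\<lambda>y. f y \<omega>)}"
      by (simp add: emeasure_eq_measure)
    have QX: "{\<omega> \<in> space M. Q (\<lambda>y. f y \<omega>)} = {\<omega> \<in> space M. \<delta> / 2 \<le> \<bar>X \<omega> - m\<bar>}"
      by (simp add: Q_def X_def)
    have int: "integrable M (\<lambda>\<omega>. (X \<omega> - m)\<^sup>2)"
      unfolding power2_diff using X1 X2 by simp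
    have "(\<delta> / 2)\<^sup>2 * (p / 2) \<le> (\<delta> / 2)\<^sup>2 * measure M {\<omega> \<in> space M. \<delta> / 2 \<le> \<bar>X \<omega> - m\<bar>}"
      using pQ unfolding QX by (intro mult_left_mono) auto
    also have "\<dots> = (LINT \<omega>|M. (\<delta> / 2)\<^sup>2 * indicator {\<omega> \<in> space M. \<delta> / 2 \<le> \<bar>X \<omega> - m\<bar>} \<omega>)"
      by (simp add: Int_absorb2 subset_iff)
    also have "\<dots> \<le> (LINT \<omega>|M. (X \<omega> - m)\<^sup>2)"
    proof (rule integral_mono[OF _ int])
      show "integrable M (\<lambda>\<omega>. (\<delta> / 2)\<^sup>2 * indicator {\<omega> \<in> space M. \<delta> / 2 \<le> \<bar>X \<omega> - m\<bar>} \<omega>)"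
        by (intro integrable_mult_right integrable_real_indicator) (auto simp: emeasure_eq_measure)
      fix \<omega>
      show "(\<delta> / 2)\<^sup>2 * indicator {\<omega> \<in> space M. \<delta> / 2 \<le> \<bar>X \<omega> - m\<bar>} \<omega> \<le> (X \<omega> - m)\<^sup>2"
        using \<delta> power_mono[of "\<delta> / 2" "\<bar>X \<omega> - m\<bar>" 2] by (auto simp: indicator_def)
    qed
    also have "\<dots> = Var M (\<lambda>\<omega>. pseudometric \<psi> l (\<lambda>y. f y \<omega>) {0} {x})"
      unfolding m_def using AE_pseudometric_eq_passage[of x]
      by (intro Var_cong_AE[symmetric] X) (simp add: X_def)
    finally show ?thesis .
  qed
  then show ?thesis using p \<delta> by (intro exI[of _ "(\<delta> / 2)\<^sup>2 * (p / 2)"]) simp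
qed

end

section \<open>The direction of the perturbation\<close>

lemma lborel_distr_reflect:
  fixes x :: "'a :: euclidean_space"
  shows "distr lborel borel (\<lambda>u. x - u) = lborel"
  using lborel_affine[of "-1" x] by (simp add: density_1)

lemma lborel_integral_reflect:
  fixes k :: "'a :: euclidean_space \<Rightarrow> real"
  assumes k [measurable]: "k \<in> borel_measurable borel"
  shows "(LINT u|lborel. k (x - u)) = (LINT u|lborel. k u)"
    and "integrable lborel (\<lambda>u. k (x - u)) \<longleftrightarrow> integrable lborel k"
proof -
  have m: "(\<lambda>u. x - u) \<in> measurable lborel borel" by measurable
  show "(LINT u|lborel. k (x - u)) = (LINT u|lborel. k u)"
    using integral_distr[OF m k] by (simp add: lborel_distr_reflect)
  show "integrable lborel (\<lambda>u. k (x - u)) \<longleftrightarrow> integrable lborel k"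
    using integrable_distr_eq[OF m k] by (simp add: lborel_distr_reflect)
qed

text \<open>Any choice of \<open>g\<close> with these properties serves; positivity everywhere is what makes the convolution with
  \<open>q\<close> positive even when \<open>q\<close> has small support.\<close>

lemma positive_unit_function:
  obtains g :: "real^'n \<Rightarrow> real" and B
  where "square_integrable g" "(LINT u|lborel. g u * g u) = 1" "\<And>u. 0 < g u" "\<And>u. g u \<le> B"
proof -
  obtain g :: "real^'n \<Rightarrow> real" where g [measurable]: "g \<in> borel_measurable lborel"
    and pos: "\<And>u. 0 < g u" and le: "\<And>u. g u \<le> 1" and int: "integrable lborel g"
    using sigma_finite_measure.obtain_positive_integrable_function[OF lborel.sigma_finite_measure_axioms]
    by blast
  have int2: "integrable lborel (\<lambda>u. (g u)\<^sup>2)"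
  proof (rule Bochner_Integration.integrable_bound[OF int])
    have "(g u)\<^sup>2 \<le> g u" for u
      using pos[of u] le[of u] by (simp add: power2_eq_square mult_left_le)
    then show "AE u in lborel. norm ((g u)\<^sup>2) \<le> norm (g u)"
      using pos by (simp add: less_imp_le)
  qed measurable
  define c where "c = (LINT u|lborel. (g u)\<^sup>2)"
  have "c \<noteq> 0"
  proof
    assume "c = 0"
    then have "AE u in lborel. (g u)\<^sup>2 = 0"
      using int2 unfolding c_def by (subst (asm) integral_nonneg_eq_0_iff_AE) auto
    then have "AE u in (lborel :: (real^'n) measure). False"
      using pos by (auto elim!: eventually_mono) (metis less_irrefl)
    then show False by (simp add: AE_iff_null null_sets_def)
  qed
  moreover have "0 \<le> c" unfolding c_def by simp
  ultimately have c: "0 < c" by simp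
  show ?thesis
  proof (rule that[of "\<lambda>u. g u / sqrt c" "1 / sqrt c"])
    show "square_integrable (\<lambda>u. g u / sqrt c)"
      using int2 g by (simp add: square_integrable_def power_divide)
    have "(LINT u|lborel. (g u / sqrt c) * (g u / sqrt c)) = (LINT u|lborel. (g u)\<^sup>2 / c)"
      using c by (simp add: power2_eq_square)
    also have "\<dots> = 1" using c by (simp add: c_def)
    finally show "(LINT u|lborel. (g u / sqrt c) * (g u / sqrt c)) = 1" .
    show "0 < g u / sqrt c" "g u / sqrt c \<le> 1 / sqrt c" for u
      using pos[of u] le[of u] c by (auto simp: divide_right_mono)
  qed
qed

lemma integrable_convolution:
  fixes q g :: "'a :: euclidean_space \<Rightarrow> real"
  assumes q: "integrable lborel q" and g [measurable]: "g \<in> borel_measurable borel"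
    and B: "\<And>u. \<bar>g u\<bar> \<le> B"
  shows "integrable lborel (\<lambda>u. q (x - u) * g u)"
proof (rule Bochner_Integration.integrable_bound)
  have qm [measurable]: "q \<in> borel_measurable borel" using borel_measurable_integrable[OF q] by simp
  show "integrable lborel (\<lambda>u. B * q (x - u))"
    using q lborel_integral_reflect(2)[OF qm, of x] by simp
  show "(\<lambda>u. q (x - u) * g u) \<in> borel_measurable lborel" by measurable
  have "0 \<le> B" using B[of undefined] by linarith
  then show "AE u in lborel. norm (q (x - u) * g u) \<le> norm (B * q (x - u))"
    using B by (intro AE_I2) (simp add: abs_mult mult.commute mult_right_mono)
qed

text \<open>All translates of \<open>q\<close> have the same integral, so pointwise convergence of translates implies convergence in
  \<open>L\<^sup>1\<close> by the lemma of Scheffe, and \<open>g\<close> is bounded.\<close>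

lemma convolution_continuous:
  fixes q g :: "'a :: euclidean_space \<Rightarrow> real"
  assumes q: "integrable lborel q" "continuous_on UNIV q" and nn: "\<And>u. 0 \<le> q u"
    and g [measurable]: "g \<in> borel_measurable borel" and B: "\<And>u. \<bar>g u\<bar> \<le> B"
  shows "continuous_on UNIV (\<lambda>x. LINT u|lborel. q (x - u) * g u)"
  unfolding continuous_on_sequentially
proof (intro allI ballI impI, elim conjE)
  fix y and a :: 'a assume y: "y \<longlonglongrightarrow> a"
  have qm [measurable]: "q \<in> borel_measurable borel" using borel_measurable_integrable[OF q(1)] by simp
  have int: "integrable lborel (\<lambda>u. q (x - u))" for x
    using lborel_integral_reflect(2)[OF qm, of x] q by simp
  have B0: "0 \<le> B" using B[of undefined] by linarith
  let ?I = "\<lambda>n. LINT u|lborel. \<bar>q (y n - u) - q (a - u)\<bar>"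
  have "(\<lambda>n. \<integral>\<^sup>+u. norm (q (y n - u) - q (a - u)) \<partial>lborel) \<longlonglongrightarrow> 0"
  proof (rule Scheffe_lemma2[OF _ int])
    show "AE u in lborel. (\<lambda>n. q (y n - u)) \<longlonglongrightarrow> q (a - u)"
      by (intro AE_I2 continuous_on_tendsto_compose[OF q(2)] tendsto_intros y) auto
    have "(\<integral>\<^sup>+u. norm (q (x - u)) \<partial>lborel) = ennreal (LINT u|lborel. q u)" for x
      using int nn lborel_integral_reflect(1)[OF qm, of x] by (simp add: nn_integral_eq_integral)
    then show "(\<integral>\<^sup>+u. norm (q (y n - u)) \<partial>lborel) \<le> (\<integral>\<^sup>+u. norm (q (a - u)) \<partial>lborel)" for n
      by simp
  qed measurable
  also have "(\<lambda>n. \<integral>\<^sup>+u. norm (q (y n - u) - q (a - u)) \<partial>lborel) = (\<lambda>n. ennreal (?I n))"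
    using int by (simp add: nn_integral_eq_integral)
  finally have "?I \<longlonglongrightarrow> 0"
    by (simp add: ennreal_0[symmetric] del: ennreal_0)
  then have lim: "(\<lambda>n. B * ?I n) \<longlonglongrightarrow> 0" by (intro tendsto_mult_right_zero)
  have bnd: "norm ((LINT u|lborel. q (y n - u) * g u) - (LINT u|lborel. q (a - u) * g u)) \<le> B * ?I n" for n
  proof -
    have "(LINT u|lborel. q (y n - u) * g u) - (LINT u|lborel. q (a - u) * g u) =
        (LINT u|lborel. q (y n - u) * g u - q (a - u) * g u)"
      using integrable_convolution[OF q(1) g B] by simp
    also have "norm \<dots> \<le> (LINT u|lborel. B * \<bar>q (y n - u) - q (a - u)\<bar>)"
    proof (rule Bochner_Integration.integral_norm_bound_integral)
      show "norm (q (y n - u) * g u - q (a - u) * g u) \<le> B * \<bar>q (y n - u) - q (a - u)\<bar>" for u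
        using mult_right_mono[OF B[of u] abs_ge_zero[of "q (y n - u) - q (a - u)"]]
        by (simp add: abs_mult mult.commute flip: left_diff_distrib right_diff_distrib)
    qed (use integrable_convolution[OF q(1) g B] int in auto)
    finally show ?thesis by simp
  qed
  have "(\<lambda>n. (LINT u|lborel. q (y n - u) * g u) - (LINT u|lborel. q (a - u) * g u)) \<longlonglongrightarrow> 0"
    by (rule Lim_null_comparison[OF _ lim]) (use bnd in auto)
  then show "((\<lambda>x. LINT u|lborel. q (x - u) * g u) \<circ> y) \<longlonglongrightarrow> (LINT u|lborel. q (a - u) * g u)"
    unfolding o_def by (rule LIM_zero_cancel)
qed

lemma convolution_pos:
  fixes q g :: "'a :: euclidean_space \<Rightarrow> real"
  assumes q: "integrable lborel q" and nn: "\<And>u. 0 \<le> q u" and pos: "0 < (LINT u|lborel. q u)"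
    and g [measurable]: "g \<in> borel_measurable borel" and g0: "\<And>u. 0 < g u" and B: "\<And>u. g u \<le> B"
  shows "0 < (LINT u|lborel. q (x - u) * g u)"
proof -
  have qm [measurable]: "q \<in> borel_measurable borel" using borel_measurable_integrable[OF q] by simp
  have nn': "0 \<le> q (x - u) * g u" for u using nn g0 by (simp add: less_imp_le)
  have int: "integrable lborel (\<lambda>u. q (x - u) * g u)"
    using B g0 by (intro integrable_convolution[OF q g, where B = B]) (simp add: less_imp_le)
  have "(LINT u|lborel. q (x - u) * g u) \<noteq> 0"
  proof
    assume "(LINT u|lborel. q (x - u) * g u) = 0"
    then have "AE u in lborel. q (x - u) * g u = 0"
      using int nn' by (subst (asm) integral_nonneg_eq_0_iff_AE) auto
    then have "AE u in lborel. q (x - u) = 0"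
      by eventually_elim (metis g0 less_irrefl mult_eq_0_iff)
    then have "(LINT u|lborel. q (x - u)) = 0"
      by (rule integral_eq_zero_AE)
    then show False using pos lborel_integral_reflect(1)[OF qm, of x] by simp
  qed
  moreover have "0 \<le> (LINT u|lborel. q (x - u) * g u)" using nn' by simp
  ultimately show ?thesis by simp
qed

lemma gaussian_process_rv:
  assumes "gaussian_process M UNIV f"
  shows "gaussian_rv M (f x)"
proof -
  have "gaussian_rv M (\<lambda>\<omega>. \<Sum>j\<in>{x}. 1 * f j \<omega>)"
    using assms unfolding gaussian_process_def
    by (elim allE[of _ "{x}"]) (auto dest: spec[of _ "\<lambda>_. 1"])
  then show ?thesis by simp
qed

theorem theorem2p10:
  fixes M :: "'w measure"
    and W :: "(real^'n \<Rightarrow> real) \<Rightarrow> 'w \<Rightarrow> real"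
    and q :: "real^'n \<Rightarrow> real"
    and f :: "real^'n \<Rightarrow> 'w \<Rightarrow> real"
    and \<psi> :: "real \<Rightarrow> real"
    and l :: real
  assumes "prob_space M"
    and "basic_assumptions M W q f"
    and "\<forall>u. q u \<ge> 0"
    and "admissible_psi \<psi>"
  shows "\<exists>C>0. \<forall>x. infnorm x \<ge> 2 \<longrightarrow>
           Var M (\<lambda>\<omega>. pseudometric \<psi> l (\<lambda>y. f y \<omega>) {0} {x}) \<ge> C"
proof -
  note M = assms(1)
  have gp: "gaussian_process M UNIV f" and cont: "AE \<omega> in M. continuous_on UNIV (\<lambda>x. f x \<omega>)"
    and mean: "\<And>x. (LINT \<omega>|M. f x \<omega>) = 0" and q2: "square_integrable q" and W: "white_noise M W"
    and ma: "moving_average M W q f" and smooth: "cont_diff 3 q" and q1: "integrable lborel q"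
    and qpos: "0 < (LINT u|lborel. q u)"
    using assms(2) unfolding basic_assumptions_def by blast+
  have q0: "\<And>u. 0 \<le> q u" using assms(3) by blast
  have qm [measurable]: "q \<in> borel_measurable borel" using q2 by (simp add: square_integrable_def)
  have "\<forall>x. q differentiable (at x)" using smooth by (simp add: numeral_3_eq_3)
  then have qc: "continuous_on UNIV q"
    by (intro differentiable_imp_continuous_on) (simp add: differentiable_on_def)
  have q2': "square_integrable (\<lambda>u. q (x - u))" for x
    using q2 lborel_integral_reflect(2)[of "\<lambda>u. (q u)\<^sup>2" x] by (simp add: square_integrable_def)
  note frv = gaussian_process_rv[OF gp]
  have fm [measurable]: "f x \<in> borel_measurable M" for x using frv by (simp add: gaussian_rv_def)
  obtain g :: "real^'n \<Rightarrow> real" and B where g2: "square_integrable g"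
    and g1: "(LINT u|lborel. g u * g u) = 1" and g0: "\<And>u. 0 < g u" and gB: "\<And>u. g u \<le> B"
    using positive_unit_function by blast
  have gm [measurable]: "g \<in> borel_measurable borel" using g2 by (simp add: square_integrable_def)
  have gB': "\<bar>g u\<bar> \<le> B" for u using g0[of u] gB[of u] by simp
  define h where "h x = (LINT u|lborel. q (x - u) * g u)" for x
  obtain D :: "(real^'n) set" where D: "countable D"
    and dense: "\<And>X. open X \<Longrightarrow> X \<noteq> {} \<Longrightarrow> \<exists>d\<in>D. d \<in> X"
    by (erule countable_dense_setE)
  have Wm: "W (\<lambda>u. q (x - u)) \<in> borel_measurable M" for x
    using white_noise_gaussian_rv[OF W q2'] by (simp add: gaussian_rv_def)
  interpret perturbed_field M f "W g" h \<psi> l D "LINT u|lborel. q u * q u"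
  proof (rule perturbed_field.intro)
    show "prob_space M" by (rule M)
    show "AE \<omega> in M. continuous_on UNIV (\<lambda>x. f x \<omega>)" by (rule cont)
    show "admissible_psi \<psi>" by (rule assms(4))
    show "countable D" by (rule D)
    show "f x \<in> borel_measurable M" for x by (rule fm)
    show "W g \<in> borel_measurable M"
      using white_noise_gaussian_rv[OF W g2] by (simp add: gaussian_rv_def)
    show "integrable M (\<lambda>\<omega>. (f x \<omega>)\<^sup>2)" for x
      by (rule gaussian_rv_centered(1)[OF M frv mean])
    show "(LINT \<omega>|M. (f x \<omega>)\<^sup>2) = (LINT u|lborel. q u * q u)" for x
    proof -
      have "(LINT \<omega>|M. (f x \<omega>)\<^sup>2) = (LINT \<omega>|M. W (\<lambda>u. q (x - u)) \<omega> * W (\<lambda>u. q (x - u)) \<omega>)"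
      proof (rule integral_cong_AE)
        show "AE \<omega> in M. (f x \<omega>)\<^sup>2 = W (\<lambda>u. q (x - u)) \<omega> * W (\<lambda>u. q (x - u)) \<omega>"
          using ma[unfolded moving_average_def, rule_format, of x]
          by eventually_elim (simp add: power2_eq_square)
      qed (use Wm in measurable)
      also have "\<dots> = (LINT u|lborel. q (x - u) * q (x - u))"
        using W q2' unfolding white_noise_def by blast
      also have "\<dots> = (LINT u|lborel. q u * q u)"
        using lborel_integral_reflect(1)[of "\<lambda>u. q u * q u" x] by simp
      finally show ?thesis .
    qed
    show "continuous_on UNIV h"
      unfolding h_def by (rule convolution_continuous[OF q1 qc q0 gm gB'])
    show "0 < h x" for x
      unfolding h_def by (rule convolution_pos[OF q1 q0 qpos gm g0 gB])
    show "distr M (\<Pi>\<^sub>M x\<in>UNIV. borel) (\<lambda>\<omega> x. f x \<omega>) =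
        distr (M \<Otimes>\<^sub>M std_normal_distribution) (\<Pi>\<^sub>M x\<in>UNIV. borel)
          (\<lambda>z x. f x (fst z) - W g (fst z) * h x + snd z * h x)"
      by (rule resampled_field_law[OF M W ma fm q2' g2 g1 h_def])
    show "\<exists>w\<in>D. dist w v < d" if "0 < d" for v d
      using dense[of "ball v d"] that by (auto simp: dist_commute)
  qed
  obtain C where "0 < C" and C: "\<And>x. 1 \<le> norm x \<Longrightarrow>
      C \<le> Var M (\<lambda>\<omega>. pseudometric \<psi> l (\<lambda>y. f y \<omega>) {0} {x})"
    using variance_lower_bound by blast
  moreover have "1 \<le> norm x" if "2 \<le> infnorm x" for x :: "real^'n"
    using that infnorm_le_norm[of x] by linarith
  ultimately show ?thesis by blast
qed

end
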